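(* Let $q\in(-1,1]$, $\mathbf m\in\mathbb R^d$, $\boldsymbol\sigma\in(0,\infty)^d$, $\boldsymbol\rho\in(-1,1)^{d-1}$. Every marginal distribution of the multidimensional $q$-Normal distribution $N_d(\mathbf m,\boldsymbol\sigma^2,\boldsymbol\rho|q)$ is multidimensional $q$-Normal: if $(X_1,\dots,X_d)\sim N_d(\mathbf m,\boldsymbol\sigma^2,\boldsymbol\rho|q)$ and $1\le i_1<\dots<i_p\le d$, then $(X_{i_1},\dots,X_{i_p})$ has a distribution of the form $N_p(\mathbf m',\boldsymbol\sigma'^2,\boldsymbol\rho'|q)$. In particular every one-dimensional marginal is $q$-Normal; more precisely, the $i$-th coordinate $X_i$ has the $(m_i,\sigma_i^2,q)$-Normal distribution.
   Context: Convention $0^0=1$. $S(q)=[-2/\sqrt{1-q},\,2/\sqrt{1-q}]$ for $|q|<1$, $S(1)=\mathbb R$. For $|q|<1$ and $x\in S(q)$, $$f_N(x|q)=\frac{\sqrt{1-q}}{2\pi\sqrt{4-(1-q)x^2}}\prod_{k=0}^\infty\big((1+q^k)^2-(1-q)x^2q^k\big)\prod_{k=0}^\infty(1-q^{k+1}),$$ and for $|\rho|<1$, $x,y\in S(q)$, $$f_{CN}(x|y,\rho,q)=f_N(x|q)\prod_{k=0}^\infty\frac{1-\rho^2q^k}{(1-\rho^2q^{2k})^2-(1-q)\rho q^k(1+\rho^2q^{2k})xy+(1-q)\rho^2(x^2+y^2)q^{2k}};$$ both are $0$ for $x\notin S(q)$ (and at the endpoints). For $q=1$: $f_N(x|1)=\frac1{\sqrt{2\pi}}e^{-x^2/2}$,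 $f_{CN}(x|y,\rho,1)=\frac1{\sqrt{2\pi(1-\rho^2)}}\exp\!\big(-\frac{(x-\rho y)^2}{2(1-\rho^2)}\big)$. The $(m,\sigma^2,q)$-Normal distribution ($m\in\mathbb R$, $\sigma>0$) has density $f_N((x-m)/\sigma|q)/\sigma$. The multidimensional $q$-Normal distribution $N_d(\mathbf m,\boldsymbol\sigma^2,\boldsymbol\rho|q)$, with $\mathbf m=(m_1,\dots,m_d)$, $\boldsymbol\sigma^2=(\sigma_1^2,\dots,\sigma_d^2)$, $\boldsymbol\rho=(\rho_1,\dots,\rho_{d-1})$, is the distribution on $\mathbb R^d$ with density $$f_N\Big(\tfrac{x_1-m_1}{\sigma_1}\Big|q\Big)\prod_{i=1}^{d-1}f_{CN}\Big(\tfrac{x_{i+1}-m_{i+1}}{\sigma_{i+1}}\Big|\tfrac{x_i-m_i}{\sigma_i},\rho_i,q\Big)\Big/\prod_{i=1}^d\sigma_i$$ where all $(x_i-m_i)/\sigma_i\in S(q)$, and zero elsewhere; $N_1(m,\sigma^2|q)$ is the $(m,\sigma^2,q)$-Normal distribution. *)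

theory Defs
  imports "HOL-Probability.Probability"
begin

definition qS :: "real \<Rightarrow> real set" where
  "qS q = (if q = 1 then UNIV else {- 2 / sqrt (1 - q) .. 2 / sqrt (1 - q)})"

text \<open>
  For \<open>q \<noteq> 1\<close> the formulas below are meant for \<open>\<bar>q\<bar> < 1\<close>. At the end points of \<open>qS q\<close> the
  square root in the denominator is \<open>0\<close>, so \<open>fN\<close> and \<open>fCN\<close> vanish there because \<open>a / 0 = 0\<close>.
\<close>

definition fN :: "real \<Rightarrow> real \<Rightarrow> real" where
  "fN q x =
    (if q = 1 then 1 / sqrt (2 * pi) * exp (- (x\<^sup>2) / 2)
     else if x \<in> qS q then
       sqrt (1 - q) / (2 * pi * sqrt (4 - (1 - q) * x\<^sup>2))
         * (\<Prod>k. (1 + q ^ k)\<^sup>2 - (1 - q) * x\<^sup>2 * q ^ k)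
         * (\<Prod>k. 1 - q ^ (k + 1))
     else 0)"

text \<open>
  \<open>fCN q \<rho> y x\<close> is the conditional density at \<open>x\<close> given \<open>y\<close>, for \<open>\<bar>\<rho>\<bar> < 1\<close> and \<open>y \<in> qS q\<close>.
  For \<open>q \<noteq> 1\<close> it vanishes for \<open>x \<notin> qS q\<close> through the factor \<open>fN q x\<close>.
\<close>

definition fCN :: "real \<Rightarrow> real \<Rightarrow> real \<Rightarrow> real \<Rightarrow> real" where
  "fCN q \<rho> y x =
    (if q = 1 then
       1 / sqrt (2 * pi * (1 - \<rho>\<^sup>2)) * exp (- ((x - \<rho> * y)\<^sup>2) / (2 * (1 - \<rho>\<^sup>2)))
     else
       fN q x *
       (\<Prod>k. (1 - \<rho>\<^sup>2 * q ^ k) /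
             ((1 - \<rho>\<^sup>2 * q ^ (2 * k))\<^sup>2
              - (1 - q) * \<rho> * q ^ k * (1 + \<rho>\<^sup>2 * q ^ (2 * k)) * x * y
              + (1 - q) * \<rho>\<^sup>2 * (x\<^sup>2 + y\<^sup>2) * q ^ (2 * k))))"

text \<open>
  As for \<^const>\<open>normal_density\<close>, the scale parameter is the standard deviation \<open>\<sigma>\<close>, not \<open>\<sigma>\<^sup>2\<close>.
\<close>

definition qNormal_density :: "real \<Rightarrow> real \<Rightarrow> real \<Rightarrow> real \<Rightarrow> real" where
  "qNormal_density q m \<sigma> x = fN q ((x - m) / \<sigma>) / \<sigma>"

text \<open>
  Vectors in dimension \<open>d\<close> are functions on \<open>{1..d}\<close>, and \<open>\<rho>\<close> is used on \<open>{1..<d}\<close> only. The density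
  is with respect to \<open>d\<close>-dimensional Lebesgue measure \<open>\<Pi>\<^sub>M i\<in>{1..d}. lborel\<close>.
\<close>

definition multi_qNormal_density ::
  "real \<Rightarrow> nat \<Rightarrow> (nat \<Rightarrow> real) \<Rightarrow> (nat \<Rightarrow> real) \<Rightarrow> (nat \<Rightarrow> real) \<Rightarrow> (nat \<Rightarrow> real) \<Rightarrow> real" where
  "multi_qNormal_density q d m \<sigma> \<rho> x =
    (if \<forall>i\<in>{1..d}. (x i - m i) / \<sigma> i \<in> qS q then
       fN q ((x 1 - m 1) / \<sigma> 1)
       * (\<Prod>i\<in>{1..<d}. fCN q (\<rho> i) ((x i - m i) / \<sigma> i) ((x (i + 1) - m (i + 1)) / \<sigma> (i + 1)))
       / (\<Prod>i\<in>{1..d}. \<sigma> i)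
     else 0)"

lemma fN_1: "fN 1 = std_normal_density"
  by (simp add: fun_eq_iff fN_def std_normal_density_def)

lemma fCN_1:
  assumes "\<bar>\<rho>\<bar> < 1"
  shows "fCN 1 \<rho> y = normal_density (\<rho> * y) (sqrt (1 - \<rho>\<^sup>2))"
proof -
  have "\<rho>\<^sup>2 < 1"
    using assms by (simp add: abs_square_less_1)
  then show ?thesis
    by (simp add: fun_eq_iff fCN_def normal_density_def)
qed

lemma fN_eq_0:
  assumes "q < 1" "x \<notin> {- 2 / sqrt (1 - q) <..< 2 / sqrt (1 - q)}"
  shows "fN q x = 0"
proof (cases "x \<in> qS q")
  case True
  then have "\<bar>x\<bar> = 2 / sqrt (1 - q)"
    using assms by (auto simp: qS_def)
  then have "\<bar>x\<bar>\<^sup>2 = (2 / sqrt (1 - q))\<^sup>2"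
    by simp
  then have "(1 - q) * x\<^sup>2 = 4"
    using assms(1) by (simp add: power_divide field_simps)
  then show ?thesis
    using assms(1) by (simp add: fN_def)
qed (use assms in \<open>simp add: fN_def\<close>)

lemma multi_qNormal_density_1:
  "multi_qNormal_density q 1 m \<sigma> \<rho> x = qNormal_density q (m 1) (\<sigma> 1) (x 1)"
  by (auto simp: multi_qNormal_density_def qNormal_density_def fN_def qS_def)

end

(*
  For q = 1 the transition densities fCN are Gaussian and convolve. For |q| < 1 put
  x = 2 cos theta / sqrt (1 - q). Then fN and the factor fCN / fN become products of q-Pochhammer
  symbols (a; q)_inf in exp (i theta), and both the normalisation of fCN and its Chapman-Kolmogorov
  equation (correlations multiply) are instances of the Askey-Wilson integral with parameters
  rho_1 exp (+- i phi), rho_2 exp (+- i psi). That integral satisfies a first-order q-difference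
  equation in each parameter, obtained by shifting the contour |z| = 1 to |z| = |q|; iterating it
  sends all parameters to 0, and one explicit case fixes the constant.

  Since the density of N_d is that of a reversible Markov chain with stationary density fN,
  integrating out one coordinate (first, inner or last) gives the same form again.
*)
theory Submission
  imports Defs "HOL-Complex_Analysis.Complex_Analysis"
begin

section \<open>The infinite q-Pochhammer symbol\<close>

text \<open>In theta the Jacobian of the substitution cancels the singular denominator of
  \<open>fN\<close>, and what is left is a weight on the unit circle. The conditioning values phi
  and psi become two conjugate pairs a, b and c, d of parameters. In the evaluated integral ab and
  cd equal rho_1^2 and rho_2^2 and cancel the numerators of the two kernels, while the four mixed
  products make up the denominator of the kernel with correlation rho_1 rho_2: this is why
  correlations multiply.

  For |q| < 1, correlation 0 turns a kernel into the constant 1, so stationarity of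
  \<open>fN\<close> and total mass of \<open>fCN\<close> need no integral of their own. Parameters
  of modulus below 1 keep the poles off the annulus swept by the contour. The sign of q is harmless
  because the contour may rotate while it shrinks; only q = 0, where the annulus degenerates, is
  treated apart.

  For the d-dimensional density, joint measurability is not derived from the product formula: it is
  part of the hypothesis on the random vector and passes to the marginals by integration. Only
  measurability in one variable at a time is proved.\<close>

definition qpoch :: "complex \<Rightarrow> complex \<Rightarrow> complex" where
  "qpoch q a = (\<Prod>k. 1 - a * q ^ k)"

lemma convergent_prod_geometric:
  fixes f :: "nat \<Rightarrow> 'a :: {real_normed_field, banach, heine_borel}" and q :: 'a
  assumes "norm q < 1" "\<And>k. norm (f k - 1) \<le> C * norm (q ^ k)"
  shows "convergent_prod f"
proof -
  have "summable (\<lambda>k. C * norm q ^ k)"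
    using assms(1) by (intro summable_mult summable_geometric) simp
  moreover have "norm (norm (f k - 1)) \<le> C * norm q ^ k" for k
    using assms(2)[of k] by (simp add: norm_power)
  ultimately have "summable (\<lambda>k. norm (f k - 1))"
    using summable_comparison_test'[of "\<lambda>k. C * norm q ^ k" 0 "\<lambda>k. norm (f k - 1)"] by simp
  then show ?thesis
    by (intro abs_convergent_prod_imp_convergent_prod summable_imp_abs_convergent_prod)
qed

lemma convergent_prod_qpoch:
  assumes "norm q < 1"
  shows "convergent_prod (\<lambda>k. 1 - a * q ^ k :: complex)"
  by (rule convergent_prod_geometric[where C = "norm a", OF assms]) (simp add: norm_mult)

lemma qpoch_LIMSEQ:
  assumes "norm q < 1"
  shows "(\<lambda>n. \<Prod>k\<le>n. 1 - a * q ^ k) \<longlonglongrightarrow> qpoch q a"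
  unfolding qpoch_def by (intro convergent_prod_LIMSEQ convergent_prod_qpoch assms)

lemma qpoch_0 [simp]: "qpoch q 0 = 1"
  by (simp add: qpoch_def)

lemma qpoch_rec:
  assumes "norm q < 1"
  shows "qpoch q a = (1 - a) * qpoch q (a * q)"
proof -
  have "(\<lambda>n. (1 - a) * (\<Prod>k\<le>n. 1 - a * q * q ^ k)) \<longlonglongrightarrow> (1 - a) * qpoch q (a * q)"
    by (intro tendsto_mult_left qpoch_LIMSEQ assms)
  moreover have "(1 - a) * (\<Prod>k\<le>n. 1 - a * q * q ^ k) = (\<Prod>k\<le>Suc n. 1 - a * q ^ k)" for n
    by (subst prod.atMost_Suc_shift) (simp add: mult.assoc)
  ultimately show ?thesis
    using LIMSEQ_Suc[OF qpoch_LIMSEQ[OF assms, of a]] by (auto intro: LIMSEQ_unique)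
qed

lemma qpoch_base_0: "qpoch 0 a = 1 - a"
  using qpoch_rec[of 0 a] by simp

lemma qpoch_eq_0_iff:
  assumes "norm q < 1"
  shows "qpoch q a = 0 \<longleftrightarrow> (\<exists>k. a * q ^ k = 1)"
proof -
  have "(\<lambda>k. 1 - a * q ^ k) has_prod qpoch q a"
    unfolding qpoch_def using convergent_prod_qpoch[OF assms] by blast
  then have "qpoch q a = 0 \<longleftrightarrow> 0 \<in> range (\<lambda>k. 1 - a * q ^ k)"
    by (rule has_prod_eq_0_iff)
  then show ?thesis
    by (auto simp: image_iff)
qed

text \<open>Every zero satisfies a = q^(-k) for some k and so has modulus at least 1. This keeps the
  denominators of the Askey-Wilson weights away from 0.\<close>

lemma qpoch_nonzero:
  assumes "norm q < 1" "norm a < 1"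
  shows "qpoch q a \<noteq> 0"
proof
  assume "qpoch q a = 0"
  then obtain k where k: "a * q ^ k = 1"
    using qpoch_eq_0_iff[OF assms(1)] by auto
  have "norm a * norm q ^ k \<le> norm a * 1"
    using assms by (intro mult_left_mono power_le_one) auto
  with k assms show False
    by (metis norm_mult norm_power norm_one mult_1_right not_le)
qed

lemma qpoch_cnj:
  assumes "norm q < 1"
  shows "qpoch (cnj q) (cnj a) = cnj (qpoch q a)"
proof (rule LIMSEQ_unique)
  show "(\<lambda>n. \<Prod>k\<le>n. 1 - cnj a * cnj q ^ k) \<longlonglongrightarrow> qpoch (cnj q) (cnj a)"
    using assms by (intro qpoch_LIMSEQ) simp
  show "(\<lambda>n. \<Prod>k\<le>n. 1 - cnj a * cnj q ^ k) \<longlonglongrightarrow> cnj (qpoch q a)"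
    using tendsto_cnj[OF qpoch_LIMSEQ[OF assms, of a]] by simp
qed

text \<open>The partial products converge uniformly on the closed unit disc around any z: there |a|
  <= |z| + 1, which gives the M-test a geometric majorant.\<close>

lemma holomorphic_qpoch_UNIV:
  assumes "norm q < 1"
  shows "qpoch q holomorphic_on UNIV"
proof (rule holomorphic_uniform_sequence)
  show "(\<lambda>a. \<Prod>k<n. 1 - a * q ^ k) holomorphic_on UNIV" for n
    by (intro holomorphic_intros)
  fix z :: complex
  have "uniformly_convergent_on (cball z 1) (\<lambda>n a. \<Prod>k<n. 1 - a * q ^ k)"
  proof (rule uniformly_convergent_on_prod')
    show "uniformly_convergent_on (cball z 1) (\<lambda>N a. \<Sum>n<N. norm (1 - a * q ^ n - 1))"
    proof (rule Weierstrass_m_test'_ev)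
      have "norm a \<le> norm z + 1" if "a \<in> cball z 1" for a
        using that norm_triangle_sub[of a z] by (simp add: dist_norm norm_minus_commute)
      then show "\<forall>\<^sub>F n in sequentially. \<forall>a\<in>cball z 1. norm (norm (1 - a * q ^ n - 1)) \<le> (norm z + 1) * norm q ^ n"
        by (intro always_eventually) (auto simp: norm_mult norm_power intro!: mult_right_mono)
      show "summable (\<lambda>n. (norm z + 1) * norm q ^ n)"
        using assms by (intro summable_mult summable_geometric) simp
    qed
  qed (auto intro!: continuous_intros)
  then obtain l where l: "uniform_limit (cball z 1) (\<lambda>n a. \<Prod>k<n. 1 - a * q ^ k) l sequentially"
    by (auto simp: uniformly_convergent_on_def)
  have "l a = qpoch q a" if "a \<in> cball z 1" for a
    using tendsto_uniform_limitI[OF l that] qpoch_LIMSEQ[OF assms, of a]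
    by (metis LIMSEQ_lessThan_iff_atMost LIMSEQ_unique)
  with l have "uniform_limit (cball z 1) (\<lambda>n a. \<Prod>k<n. 1 - a * q ^ k) (qpoch q) sequentially"
    by (metis (no_types, lifting) uniform_limit_cong')
  then show "\<exists>d>0. cball z d \<subseteq> UNIV \<and>
      uniform_limit (cball z d) (\<lambda>n a. \<Prod>k<n. 1 - a * q ^ k) (qpoch q) sequentially"
    by (intro exI[of _ 1]) auto
qed auto

lemma holomorphic_on_qpoch [holomorphic_intros]:
  assumes "norm q < 1" "f holomorphic_on A"
  shows "(\<lambda>z. qpoch q (f z)) holomorphic_on A"
  using holomorphic_on_compose_gen[OF assms(2) holomorphic_qpoch_UNIV[OF assms(1)]]
  by (simp add: o_def)

lemma continuous_on_qpoch [continuous_intros]: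
  assumes "norm q < 1" "continuous_on A f"
  shows "continuous_on A (\<lambda>z. qpoch q (f z))"
  using continuous_on_compose2[OF holomorphic_on_imp_continuous_on[OF holomorphic_qpoch_UNIV[OF assms(1)]] assms(2)]
  by auto

section \<open>Means over the unit circle\<close>

text \<open>Up to the factor 2 pi i this is the contour integral of f z / z over the unit circle.
  The form dz / z is used because rotation, scaling and inversion preserve it up to
  orientation.\<close>

definition circle_mean :: "(complex \<Rightarrow> complex) \<Rightarrow> complex" where
  "circle_mean f = integral {0..1} (\<lambda>t. f (cis (2 * pi * t)))"

lemma circle_mean_cong:
  assumes "\<And>z. norm z = 1 \<Longrightarrow> f z = g z"
  shows "circle_mean f = circle_mean g"
  unfolding circle_mean_def by (intro Henstock_Kurzweil_Integration.integral_cong assms) simp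

lemma continuous_on_cis_comp:
  assumes "continuous_on (sphere 0 1) f"
  shows "continuous_on A (\<lambda>t. f (cis (2 * pi * t)))"
  by (rule continuous_on_compose2[OF assms]) (auto intro!: continuous_intros)

lemma integrable_on_circle:
  fixes f :: "complex \<Rightarrow> complex"
  assumes "continuous_on (sphere 0 1) f"
  shows "(\<lambda>t. f (cis (2 * pi * t))) integrable_on {a..b}"
  by (intro integrable_continuous_real continuous_on_cis_comp assms)

lemma circle_mean_add:
  assumes "continuous_on (sphere 0 1) f" "continuous_on (sphere 0 1) g"
  shows "circle_mean (\<lambda>z. f z + g z) = circle_mean f + circle_mean g"
  unfolding circle_mean_def
  by (intro Henstock_Kurzweil_Integration.integral_add integrable_on_circle assms)

lemma circle_mean_mult: "circle_mean (\<lambda>z. c * f z) = c * circle_mean f"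
  unfolding circle_mean_def by simp

lemma circle_mean_inverse: "circle_mean (\<lambda>z. f (1 / z)) = circle_mean f"
proof -
  have refl: "((\<lambda>t. g (1 - t)) has_integral i) {0..1}" if "(g has_integral i) {0..1}"
    for g :: "real \<Rightarrow> complex" and i
    using has_integral_affinity[of g i 0 1 "-1" 1] that by simp
  \<comment> \<open>Reflection is an involution, so both functions have the same integrals i; hence
    the means agree even if f is not integrable.\<close>
  have "((\<lambda>t. f (cis (2 * pi * (1 - t)))) has_integral i) {0..1} \<longleftrightarrow>
        ((\<lambda>t. f (cis (2 * pi * t))) has_integral i) {0..1}" for i
    using refl[of "\<lambda>t. f (cis (2 * pi * t))" i] refl[of "\<lambda>t. f (cis (2 * pi * (1 - t)))" i]
    by auto
  moreover have "f (cis (2 * pi * (1 - t))) = f (1 / cis (2 * pi * t))" for t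
    using cis_divide[of "2 * pi" "2 * pi * t"] by (simp add: right_diff_distrib)
  ultimately show ?thesis
    by (simp only: circle_mean_def integral_def integrable_on_def)
qed

text \<open>The derivative of the path is 2 pi i times the path itself, so dz / z contributes a
  constant and c survives only inside f.\<close>

lemma contour_integral_scaled_circle:
  assumes "c \<noteq> 0"
  shows "contour_integral (\<lambda>t. c * cis (2 * pi * t)) (\<lambda>z. f z / z) = 2 * pi * \<i> * circle_mean (\<lambda>z. f (c * z))"
proof -
  have *: "((\<lambda>t. c * cis (2 * pi * t)) has_vector_derivative c * (2 * pi * \<i> * cis (2 * pi * t))) (at t within A)" for t A
  proof -
    have "((\<lambda>z. c * exp (2 * pi * \<i> * z)) has_field_derivative c * (2 * pi * \<i> * exp (2 * pi * \<i> * t))) (at (of_real t))"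
      by (auto intro!: derivative_eq_intros)
    from has_vector_derivative_real_field[OF this] show ?thesis
      by (simp add: cis_conv_exp mult_ac)
  qed
  have "contour_integral (\<lambda>t. c * cis (2 * pi * t)) (\<lambda>z. f z / z) =
     integral {0..1} (\<lambda>t. f (c * cis (2 * pi * t)) / (c * cis (2 * pi * t)) * (c * (2 * pi * \<i> * cis (2 * pi * t))))"
    unfolding contour_integral_integral
    by (intro integral_cong) (simp_all add: vector_derivative_at[OF *])
  also have "\<dots> = integral {0..1} (\<lambda>t. 2 * pi * \<i> * f (c * cis (2 * pi * t)))"
    using assms by (intro Henstock_Kurzweil_Integration.integral_cong) (simp add: field_simps)
  finally show ?thesis
    by (simp add: circle_mean_def)
qed

text \<open>Since f z / z is holomorphic near the closed annulus between the radii norm q and 1, its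
  integrals over the two bounding circles agree.\<close>

lemma circle_mean_scale:
  assumes "open S" "f holomorphic_on S" "q \<noteq> 0" "0 \<notin> S"
    and S: "\<And>z. norm q \<le> norm z \<Longrightarrow> norm z \<le> 1 \<Longrightarrow> z \<in> S"
    and "norm q < 1"
  shows "circle_mean (\<lambda>z. f (q * z)) = circle_mean f"
proof -
  let ?\<gamma> = "\<lambda>c t. c * cis (2 * pi * t)"
  let ?h = "\<lambda>(s, t). exp (of_real s * Ln q) * cis (2 * pi * t)"
  \<comment> \<open>rotating while shrinking reaches every nonzero \<open>q\<close>, also a negative one\<close>
  have norm_h: "norm (exp (of_real s * Ln q)) = norm q powr s" for s
    using assms(3) by (simp add: powr_def)
  have "homotopic_loops S (?\<gamma> 1) (?\<gamma> q)"
    unfolding homotopic_loops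
  proof (intro exI conjI)
    show "continuous_on ({0..1} \<times> {0..1}) ?h"
      by (auto simp: case_prod_unfold intro!: continuous_intros)
    show "?h \<in> {0..1} \<times> {0..1} \<rightarrow> S"
    proof (clarsimp, rule S)
      fix s t :: real
      assume s: "0 \<le> s" "s \<le> 1"
      have "norm q powr 1 \<le> norm q powr s"
        using s assms by (intro powr_mono') auto
      then show "norm q \<le> norm (exp (complex_of_real s * Ln q) * cis (2 * pi * t))"
        using assms(3) norm_h by (simp add: norm_mult)
      have "norm q powr s \<le> 1"
        using s assms by (intro powr_le1) auto
      then show "norm (exp (complex_of_real s * Ln q) * cis (2 * pi * t)) \<le> 1"
        using assms(3) norm_h by (simp add: norm_mult)
    qed
  qed (use assms(3) in \<open>auto simp: pathfinish_def pathstart_def\<close>)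
  moreover have "(\<lambda>z. f z / z) holomorphic_on S"
    using assms by (auto intro!: holomorphic_intros)
  moreover have "valid_path (?\<gamma> c)" for c
  proof -
    \<comment> \<open>The path is a full turn starting at the angle \<open>Arg c\<close>; this form
      only serves to show that it is a valid path.\<close>
    have "?\<gamma> c t = part_circlepath 0 (norm c) (Arg c) (Arg c + 2 * pi) t" for t
    proof -
      have "c * cis (2 * pi * t) = norm c * (cis (Arg c) * cis (2 * pi * t))"
        by (metis mult.assoc rcis_cmod_Arg rcis_def)
      also have "cis (Arg c) * cis (2 * pi * t) = cis (linepath (Arg c) (Arg c + 2 * pi) t)"
        by (simp add: cis_mult linepath_def algebra_simps)
      finally show ?thesis
        by (simp add: part_circlepath_def cis_conv_exp)
    qed
    then show ?thesis
      using valid_path_part_circlepath[of 0 "norm c" "Arg c" "Arg c + 2 * pi"] by simp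
  qed
  ultimately have "contour_integral (?\<gamma> 1) (\<lambda>z. f z / z) = contour_integral (?\<gamma> q) (\<lambda>z. f z / z)"
    using assms(1) Cauchy_theorem_homotopic_loops by blast
  then show ?thesis
    using contour_integral_scaled_circle[of 1 f] contour_integral_scaled_circle[OF assms(3), of f]
    by simp
qed

lemma circle_mean_holomorphic:
  assumes "open S" "cball 0 1 \<subseteq> S" "f holomorphic_on S"
  shows "circle_mean f = f 0"
proof -
  have "((\<lambda>z. f z / (z - 0)) has_contour_integral 2 * pi * \<i> * f 0) (circlepath 0 1)"
    using Cauchy_integral_circlepath_simple[OF holomorphic_on_subset[OF assms(3,2)], of 0] by simp
  then have "contour_integral (circlepath 0 1) (\<lambda>z. f z / z) = 2 * pi * \<i> * f 0"
    using contour_integral_unique by simp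
  moreover have "circlepath 0 1 = (\<lambda>t. 1 * cis (2 * pi * t))"
    by (auto simp: circlepath fun_eq_iff cis_conv_exp mult_ac)
  ultimately show ?thesis
    using contour_integral_scaled_circle[of 1 f] by simp
qed

section \<open>The Askey--Wilson integral\<close>

lemma qpoch_square_base:
  assumes "norm q < 1"
  shows "qpoch (q\<^sup>2) (a\<^sup>2) = qpoch q a * qpoch q (- a)"
proof (rule LIMSEQ_unique)
  have "norm (q\<^sup>2) < 1"
    using assms by (simp add: norm_power abs_square_less_1)
  then show "(\<lambda>n. \<Prod>k\<le>n. 1 - a\<^sup>2 * (q\<^sup>2) ^ k) \<longlonglongrightarrow> qpoch (q\<^sup>2) (a\<^sup>2)"
    by (rule qpoch_LIMSEQ)
  have "(\<lambda>n. (\<Prod>k\<le>n. 1 - a * q ^ k) * (\<Prod>k\<le>n. 1 - (- a) * q ^ k)) \<longlonglongrightarrow> qpoch q a * qpoch q (- a)"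
    by (intro tendsto_mult qpoch_LIMSEQ assms)
  also have "(1 - a * q ^ k) * (1 - (- a) * q ^ k) = 1 - a\<^sup>2 * (q\<^sup>2) ^ k" for k
    by (simp add: algebra_simps power2_eq_square power_mult_distrib)
  then have "(\<lambda>n. (\<Prod>k\<le>n. 1 - a * q ^ k) * (\<Prod>k\<le>n. 1 - (- a) * q ^ k)) = (\<lambda>n. \<Prod>k\<le>n. 1 - a\<^sup>2 * (q\<^sup>2) ^ k)"
    by (simp only: prod.distrib [symmetric])
  finally show "(\<lambda>n. \<Prod>k\<le>n. 1 - a\<^sup>2 * (q\<^sup>2) ^ k) \<longlonglongrightarrow> qpoch q a * qpoch q (- a)" .
qed

text \<open>Even and odd exponents are collected separately, along the subsequence of partial
  products that contain equally many of both.\<close>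

lemma qpoch_split_even_odd:
  assumes "norm q < 1"
  shows "qpoch q a = qpoch (q\<^sup>2) a * qpoch (q\<^sup>2) (a * q)"
proof (rule LIMSEQ_unique)
  have "norm (q\<^sup>2) < 1"
    using assms by (simp add: norm_power abs_square_less_1)
  then show "(\<lambda>n. (\<Prod>k\<le>n. 1 - a * (q\<^sup>2) ^ k) * (\<Prod>k\<le>n. 1 - a * q * (q\<^sup>2) ^ k))
      \<longlonglongrightarrow> qpoch (q\<^sup>2) a * qpoch (q\<^sup>2) (a * q)"
    by (intro tendsto_mult qpoch_LIMSEQ)
  have eq: "(\<Prod>k\<le>Suc (2 * n). 1 - a * q ^ k) = (\<Prod>k\<le>n. 1 - a * (q\<^sup>2) ^ k) * (\<Prod>k\<le>n. 1 - a * q * (q\<^sup>2) ^ k)" for n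
  proof (induction n)
    case (Suc n)
    have "(q\<^sup>2) ^ Suc n = q ^ Suc (Suc (2 * n))"
      using power_mult[of q 2 "Suc n"] by simp
    moreover have "(\<Prod>k\<le>Suc (2 * Suc n). 1 - a * q ^ k) = (\<Prod>k\<le>Suc (2 * n). 1 - a * q ^ k) *
        ((1 - a * q ^ Suc (Suc (2 * n))) * (1 - a * q * q ^ Suc (Suc (2 * n))))"
      by simp
    ultimately show ?case
      by (simp only: prod.atMost_Suc[of _ n] Suc.IH) (simp only: mult_ac)
  qed simp
  have "strict_mono (\<lambda>n. Suc (2 * n))"
    by (simp add: strict_mono_Suc_iff)
  from LIMSEQ_subseq_LIMSEQ[OF qpoch_LIMSEQ[OF assms, of a] this]
  show "(\<lambda>n. (\<Prod>k\<le>n. 1 - a * (q\<^sup>2) ^ k) * (\<Prod>k\<le>n. 1 - a * q * (q\<^sup>2) ^ k)) \<longlonglongrightarrow> qpoch q a"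
    by (simp only: o_def eq)
qed

section \<open>The q-difference equation in one parameter\<close>

definition qpoch_pair :: "complex \<Rightarrow> complex \<Rightarrow> complex \<Rightarrow> complex" where
  "qpoch_pair q a z = qpoch q (a * z) * qpoch q (a / z)"

text \<open>At z = exp (i theta) this is the classical weight of the Askey-Wilson polynomials in cos
  theta, taken with respect to d theta.\<close>

definition aw_weight :: "complex \<Rightarrow> complex \<Rightarrow> complex \<Rightarrow> complex \<Rightarrow> complex \<Rightarrow> complex \<Rightarrow> complex" where
  "aw_weight q a b c d z = qpoch q (z\<^sup>2) * qpoch q (1 / z\<^sup>2) /
     (qpoch_pair q a z * qpoch_pair q b z * qpoch_pair q c z * qpoch_pair q d z)"

definition aw_integral :: "complex \<Rightarrow> complex \<Rightarrow> complex \<Rightarrow> complex \<Rightarrow> complex \<Rightarrow> complex" where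
  "aw_integral q a b c d = circle_mean (aw_weight q a b c d)"

lemma aw_weight_perm:
  "aw_weight q a b c d = aw_weight q b a c d"
  "aw_weight q a b c d = aw_weight q c b a d"
  "aw_weight q a b c d = aw_weight q d b c a"
  by (simp_all add: aw_weight_def mult_ac fun_eq_iff)

lemma qpoch_pair_rec:
  assumes "norm q < 1"
  shows "qpoch_pair q a z = (1 - a * z) * (1 - a / z) * qpoch_pair q (a * q) z"
  using qpoch_rec[OF assms, of "a * z"] qpoch_rec[OF assms, of "a / z"]
  by (simp add: qpoch_pair_def mult_ac)

lemma continuous_on_aw_weight:
  assumes "norm q < 1" "norm a < 1" "norm b < 1" "norm c < 1" "norm d < 1"
  shows "continuous_on (sphere 0 1) (aw_weight q a b c d)"
proof -
  have "z \<noteq> 0" if "z \<in> sphere 0 1" for z :: complex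
    using that by auto
  moreover have "qpoch q (e * z) \<noteq> 0" "qpoch q (e / z) \<noteq> 0" if "norm e < 1" "norm z = 1" for e z
    using that assms(1) by (auto simp: qpoch_nonzero norm_mult norm_divide)
  ultimately show ?thesis
    unfolding aw_weight_def qpoch_pair_def using assms
    by (intro continuous_intros) auto
qed

text \<open>This function changes sign under \<open>z \<mapsto> q / z\<close>, so shifting the contour from \<open>norm z = 1\<close> to
  \<open>norm z = norm q\<close> shows that its mean vanishes; symmetrised under \<open>z \<mapsto> 1 / z\<close> it is the
  Askey--Wilson weight times a linear polynomial in \<open>z + 1 / z\<close>.\<close>

definition aw_shift :: "complex \<Rightarrow> complex \<Rightarrow> complex \<Rightarrow> complex \<Rightarrow> complex \<Rightarrow> complex \<Rightarrow> complex" where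
  "aw_shift q a b c d z = qpoch q (q * z\<^sup>2) * qpoch q (1 / z\<^sup>2) * z ^ 3 /
    (qpoch q (a * z) * qpoch q (q * a / z) * (qpoch q (b * z) * qpoch q (q * b / z)) *
     (qpoch q (c * z) * qpoch q (q * c / z)) * (qpoch q (d * z) * qpoch q (q * d / z)))"

text \<open>Passing from 1 / z to q * z swaps the two symbols of each denominator pair, so only the
  numerators matter. Their quotient is rational because the arguments of corresponding symbols
  differ by the factor q^3, which is bridged by three steps of the recurrence.\<close>

lemma aw_shift_q:
  assumes "norm q < 1" "q \<noteq> 0" "z \<noteq> 0"
  shows "aw_shift q a b c d (q * z) = - aw_shift q a b c d (1 / z)"
proof -
  have rec: "qpoch q x = (1 - x) * ((1 - x * q) * ((1 - x * q\<^sup>2) * qpoch q (x * q ^ 3)))" for x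
    using qpoch_rec[OF assms(1), of x] qpoch_rec[OF assms(1), of "x * q"] qpoch_rec[OF assms(1), of "x * q\<^sup>2"]
    by (simp add: power2_eq_square power3_eq_cube mult.assoc)
  define u where "u = 1 / z"
  define r where "r = 1 / q"
  have inv: "z * u = 1" "q * r = 1"
    using assms by (auto simp: u_def r_def)
  have P2: "qpoch q ((r * u)\<^sup>2) = (1 - (r * u)\<^sup>2) * ((1 - r * u\<^sup>2) * ((1 - u\<^sup>2) * qpoch q (q * u\<^sup>2)))"
  proof -
    have "(r * u)\<^sup>2 * q = r * u\<^sup>2" "(r * u)\<^sup>2 * q\<^sup>2 = u\<^sup>2" "(r * u)\<^sup>2 * q ^ 3 = q * u\<^sup>2"
      using inv(2) by algebra+
    then show ?thesis
      using rec[of "(r * u)\<^sup>2"] by simp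
  qed
  have P4: "qpoch q (z\<^sup>2) = (1 - z\<^sup>2) * ((1 - q * z\<^sup>2) * ((1 - (q * z)\<^sup>2) * qpoch q (q * (q * z)\<^sup>2)))"
  proof -
    have "z\<^sup>2 * q = q * z\<^sup>2" "z\<^sup>2 * q\<^sup>2 = (q * z)\<^sup>2" "z\<^sup>2 * q ^ 3 = q * (q * z)\<^sup>2"
      by algebra+
    then show ?thesis
      using rec[of "z\<^sup>2"] by simp
  qed
  \<comment> \<open>Three pairs 1 - 1 / x and 1 - x, each with quotient - 1 / x, produce the sign
    and the monomial r^3 u^6; the factor (q z)^3 reduces it to u^3. This explains the exponent 3 in
    \<open>aw_shift\<close>.\<close>
  have "(1 - (r * u)\<^sup>2) * ((1 - r * u\<^sup>2) * (1 - u\<^sup>2)) * (q * z) ^ 3 =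
      - ((1 - z\<^sup>2) * ((1 - q * z\<^sup>2) * (1 - (q * z)\<^sup>2)) * u ^ 3)"
    using inv by algebra
  then have "qpoch q (q * (q * z)\<^sup>2) * qpoch q (q * u\<^sup>2) * ((1 - (r * u)\<^sup>2) * ((1 - r * u\<^sup>2) * (1 - u\<^sup>2)) * (q * z) ^ 3) =
      qpoch q (q * (q * z)\<^sup>2) * qpoch q (q * u\<^sup>2) * - ((1 - z\<^sup>2) * ((1 - q * z\<^sup>2) * (1 - (q * z)\<^sup>2)) * u ^ 3)"
    by (rule arg_cong)
  then have num: "qpoch q (q * (q * z)\<^sup>2) * qpoch q ((r * u)\<^sup>2) * (q * z) ^ 3 =
      - (qpoch q (q * u\<^sup>2) * qpoch q (z\<^sup>2) * u ^ 3)"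
    unfolding P2 P4 by (simp only: mult_ac mult_minus_right)
  have args: "1 / (q * z)\<^sup>2 = (r * u)\<^sup>2" "1 / u\<^sup>2 = z\<^sup>2" "q * e / (q * z) = e * u" "e / u = e * z"
    "e * (q * z) = q * e * z" for e
    using assms by (simp_all add: u_def r_def power_divide)
  show ?thesis
    unfolding aw_shift_def u_def[symmetric] args num by (simp add: mult_ac)
qed

text \<open>For nonzero q the mean equals its own negative: the contour shift allows z to be
  replaced by q * z, and \<open>aw_shift_q\<close> together with inversion turns the result into
  minus the mean.\<close>

lemma circle_mean_aw_shift:
  assumes "norm q < 1" "norm a < 1" "norm b < 1" "norm c < 1" "norm d < 1"
  shows "circle_mean (aw_shift q a b c d) = 0"
proof (cases "q = 0")
  \<comment> \<open>There is no inner circle at q = 0, but on the unit circle the function then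
    agrees with one that is holomorphic near the closed disc and vanishes at 0.\<close>
  case True
  let ?f = "\<lambda>z. z * (z\<^sup>2 - 1) / ((1 - a * z) * (1 - b * z) * (1 - c * z) * (1 - d * z))"
  let ?S = "{z. norm (a * z) < 1} \<inter> {z. norm (b * z) < 1} \<inter> {z. norm (c * z) < 1} \<inter> {z. norm (d * z) < 1}"
  have "circle_mean (aw_shift q a b c d) = circle_mean ?f"
  proof (rule circle_mean_cong)
    fix z :: complex assume "norm z = 1"
    then have "z * (1 / z) = 1"
      by auto
    then have "(1 - (1 / z)\<^sup>2) * z ^ 3 = z * (z\<^sup>2 - 1)"
      by algebra
    then show "aw_shift q a b c d z = ?f z"
      by (simp add: aw_shift_def True qpoch_base_0 power_one_over)
  qed
  also have "\<dots> = ?f 0"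
  proof (rule circle_mean_holomorphic)
    show "open ?S"
      by (intro open_Int open_Collect_less continuous_intros)
    have "norm (e * z) < 1" if "norm e < 1" "norm z \<le> 1" for e z :: complex
      using that mult_left_mono[of "norm z" 1 "norm e"] by (simp add: norm_mult)
    then show "cball 0 1 \<subseteq> ?S"
      using assms by auto
    show "?f holomorphic_on ?S"
      by (intro holomorphic_intros) auto
  qed
  finally show ?thesis
    by (simp only: mult_zero_left div_0)
next
  case False
  \<comment> \<open>Poles can occur only at 1 / (e q^k) and e q^(k + 1), of modulus above 1 and
    below norm q respectively. With e / z in place of q * e / z, as in \<open>aw_weight\<close>, the
    point e itself could lie in the annulus.\<close>
  define S :: "complex set"
    where "S = - {0} \<inter> (\<Inter>e\<in>{a, b, c, d}. {z. norm (e * z) < 1} \<inter> {z. norm (q * e) < norm z})"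
  have "circle_mean (\<lambda>z. aw_shift q a b c d (q * z)) = circle_mean (aw_shift q a b c d)"
  proof (rule circle_mean_scale)
    show "open S"
      unfolding S_def by (intro open_Int open_INT ballI open_Collect_less continuous_intros) auto
    have *: "norm (e * z) < 1" if "norm e < 1" "norm z \<le> 1" for e z :: complex
      using that mult_left_mono[of "norm z" 1 "norm e"] by (simp add: norm_mult)
    have **: "norm (q * e) < norm z" if "norm e < 1" "norm q \<le> norm z" for e z :: complex
    proof -
      have "norm q * norm e < norm q * 1"
        using that False by (intro mult_strict_left_mono) auto
      then show ?thesis
        using that by (simp add: norm_mult)
    qed
    show "z \<in> S" if "norm q \<le> norm z" "norm z \<le> 1" for z
      using that assms False * ** by (auto simp: S_def)
    show "aw_shift q a b c d holomorphic_on S"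
      unfolding aw_shift_def
      by (intro holomorphic_intros) (use assms in \<open>auto simp: S_def qpoch_nonzero norm_divide divide_less_eq\<close>)
  qed (use False assms in \<open>auto simp: S_def\<close>)
  also have "circle_mean (\<lambda>z. aw_shift q a b c d (q * z)) = circle_mean (\<lambda>z. (- 1) * aw_shift q a b c d (1 / z))"
    proof (rule circle_mean_cong)
    fix z :: complex assume "norm z = 1"
    then have "z \<noteq> 0"
      by auto
    then show "aw_shift q a b c d (q * z) = (- 1) * aw_shift q a b c d (1 / z)"
      using aw_shift_q[OF assms(1) False] by simp
  qed
  also have "\<dots> = - circle_mean (aw_shift q a b c d)"
    by (subst circle_mean_mult, subst circle_mean_inverse) simp
  finally show ?thesis
    by simp
qed

text \<open>Once the first factor of each symbol is split off where necessary, all three functions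
  are one infinite product \<open>C\<close> times a Laurent polynomial. In the elementary symmetric
  functions e1, ..., e4 of the parameters, the bracket is e1 - e3 - (1 - e4) (z + 1 / z).\<close>

lemma aw_shift_symmetrized:
  assumes "norm q < 1" "norm a < 1" "norm b < 1" "norm c < 1" "norm d < 1" "norm z = 1"
  shows "aw_shift q a b c d z + aw_shift q a b c d (1 / z) =
    aw_weight q a b c d z * (a + b + c + d - (a * b * c + a * b * d + a * c * d + b * c * d)
      - (1 - a * b * c * d) * (z + 1 / z))"
proof -
  define u where "u = 1 / z"
  have z: "z \<noteq> 0" and zu: "z * u = 1"
    using assms(6) by (auto simp: u_def)
  have rec: "qpoch q x = (1 - x) * qpoch q (q * x)" for x
    using qpoch_rec[OF assms(1), of x] by (simp add: mult_ac)
  have nz: "1 - e * z \<noteq> 0" "1 - e * u \<noteq> 0" "qpoch q (q * (e * z)) \<noteq> 0" "qpoch q (q * (e * u)) \<noteq> 0" if "norm e < 1" for e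
    using qpoch_nonzero[OF assms(1), of "e * z"] qpoch_nonzero[OF assms(1), of "e * u"] assms(6) that
      rec[of "e * z"] rec[of "e * u"]
    by (auto simp: norm_mult norm_divide u_def)
  define N where "N = qpoch q (q * z\<^sup>2) * qpoch q (q * u\<^sup>2)"
  define D where "D e = qpoch q (q * (e * z)) * qpoch q (q * (e * u))" for e
  define P where "P e = (1 - e * z)" for e
  define R where "R e = (1 - e * u)" for e
  have nz': "P e \<noteq> 0" "R e \<noteq> 0" "D e \<noteq> 0" if "norm e < 1" for e
    using nz[OF that] by (auto simp: P_def R_def D_def)
  define C where "C = N / ((P a * R a * D a) * (P b * R b * D b) * (P c * R c * D c) * (P d * R d * D d))"
  have pair: "qpoch_pair q e z = P e * R e * D e" for e
  proof -
    have "e / z = e * u"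
      by (simp add: u_def)
    then show ?thesis
      unfolding qpoch_pair_def P_def R_def D_def
      by (simp only: rec[of "e * z"] rec[of "e * u"] mult_ac)
  qed
  have 1: "aw_weight q a b c d z = C * ((1 - z\<^sup>2) * (1 - u\<^sup>2))"
    unfolding aw_weight_def pair C_def N_def using rec[of "z\<^sup>2"] rec[of "u\<^sup>2"]
    by (simp add: u_def power_divide)
  have shift: "qpoch q (e * z) * qpoch q (q * e / z) = P e * D e"
     "qpoch q (e * (1 / z)) * qpoch q (q * e / (1 / z)) = R e * D e" for e
  proof -
    have "q * e / z = q * (e * u)" "e * (1 / z) = e * u" "q * e / (1 / z) = q * (e * z)"
      by (simp_all add: u_def)
    then show "qpoch q (e * z) * qpoch q (q * e / z) = P e * D e"
      "qpoch q (e * (1 / z)) * qpoch q (q * e / (1 / z)) = R e * D e"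
      unfolding P_def R_def D_def by (simp_all only: rec[of "e * z"] rec[of "e * u"] mult_ac)
  qed
  have "aw_shift q a b c d z = N * ((1 - u\<^sup>2) * z ^ 3) / (P a * D a * (P b * D b) * (P c * D c) * (P d * D d))"
    unfolding aw_shift_def shift N_def using rec[of "u\<^sup>2"] by (simp add: u_def power_divide)
  also have "\<dots> = C * ((1 - u\<^sup>2) * z ^ 3 * (R a * R b * R c * R d))"
    unfolding C_def using nz' assms by simp
  finally have 2: "aw_shift q a b c d z = C * ((1 - u\<^sup>2) * z ^ 3 * (R a * R b * R c * R d))" .
  have "aw_shift q a b c d (1 / z) = N * ((1 - z\<^sup>2) * u ^ 3) / (R a * D a * (R b * D b) * (R c * D c) * (R d * D d))"
    unfolding aw_shift_def shift N_def using rec[of "z\<^sup>2"] by (simp add: u_def power_divide)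
  also have "\<dots> = C * ((1 - z\<^sup>2) * u ^ 3 * (P a * P b * P c * P d))"
    unfolding C_def using nz' assms by simp
  finally have 3: "aw_shift q a b c d (1 / z) = C * ((1 - z\<^sup>2) * u ^ 3 * (P a * P b * P c * P d))" .
  have "z ^ 3 * (R a * R b * R c * R d) = z ^ 3 - (a + b + c + d) * z\<^sup>2
      + (a * b + a * c + a * d + b * c + b * d + c * d) * z
      - (a * b * c + a * b * d + a * c * d + b * c * d) + a * b * c * d * u"
    unfolding R_def using zu by algebra
  moreover have "u ^ 3 * (P a * P b * P c * P d) = u ^ 3 - (a + b + c + d) * u\<^sup>2
      + (a * b + a * c + a * d + b * c + b * d + c * d) * u
      - (a * b * c + a * b * d + a * c * d + b * c * d) + a * b * c * d * z"
    unfolding P_def using zu by algebra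
  \<comment> \<open>The terms with e2 cancel. From all the others 2 - z^2 - u^2 splits off, which is
    (1 - z^2) (1 - u^2) because z u = 1.\<close>
  ultimately have key: "(1 - u\<^sup>2) * z ^ 3 * (R a * R b * R c * R d) + (1 - z\<^sup>2) * u ^ 3 * (P a * P b * P c * P d) =
    (1 - z\<^sup>2) * (1 - u\<^sup>2) * (a + b + c + d - (a * b * c + a * b * d + a * c * d + b * c * d)
      - (1 - a * b * c * d) * (z + u))"
    using zu by algebra
  have "aw_shift q a b c d z + aw_shift q a b c d (1 / z) =
      C * ((1 - u\<^sup>2) * z ^ 3 * (R a * R b * R c * R d) + (1 - z\<^sup>2) * u ^ 3 * (P a * P b * P c * P d))"
    unfolding 2 3 by (rule distrib_left[symmetric])
  then show ?thesis
    unfolding key 1 u_def[symmetric] by (simp only: mult.assoc)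
qed

text \<open>The weight times e1 - e3 - (1 - e4) (z + 1 / z) has mean 0. Replacing a by a q
  multiplies the weight by 1 + a^2 - a (z + 1 / z), which is linear in z + 1 / z too. Eliminating z
  + 1 / z leaves a relation between the two integrals.\<close>

lemma aw_integral_rec:
  assumes q: "norm q < 1" and abcd: "norm a < 1" "norm b < 1" "norm c < 1" "norm d < 1"
  shows "(1 - a * b * c * d) * aw_integral q (a * q) b c d =
    (1 - a * b) * (1 - a * c) * (1 - a * d) * aw_integral q a b c d"
proof -
  let ?w = "aw_weight q a b c d" and ?w' = "aw_weight q (a * q) b c d"
  let ?s = "aw_shift q a b c d"
  have aq: "norm (a * q) < 1"
    using mult_strict_mono[of "norm a" 1 "norm q" 1] q abcd by (simp add: norm_mult)
  have cont_w: "continuous_on (sphere 0 1) ?w" and cont_w': "continuous_on (sphere 0 1) ?w'"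
    using assms aq by (intro continuous_on_aw_weight; simp)+
  have cont_s: "continuous_on (sphere 0 1) ?s"
  proof -
    have "z \<noteq> 0" if "z \<in> sphere 0 1" for z :: complex
      using that by auto
    moreover have "norm (q * e) < 1" if "norm e < 1" for e
      using mult_strict_mono[of "norm q" 1 "norm e" 1] q that by (simp add: norm_mult)
    then have "qpoch q (e * z) \<noteq> 0" "qpoch q (q * e / z) \<noteq> 0" if "norm e < 1" "norm z = 1" for e z
      using that q by (auto simp: qpoch_nonzero norm_mult norm_divide)
    ultimately show ?thesis
      unfolding aw_shift_def using q abcd
      by (intro continuous_intros) auto
  qed
  have cont_s': "continuous_on (sphere 0 1) (\<lambda>z. ?s (1 / z))"
    by (rule continuous_on_compose2[OF cont_s]) (auto intro!: continuous_intros simp: norm_divide)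
  have "circle_mean (\<lambda>z. (1 - a * b) * (1 - a * c) * (1 - a * d) * ?w z + - (1 - a * b * c * d) * ?w' z) =
      circle_mean (\<lambda>z. - a * (?s z + ?s (1 / z)))"
  proof (rule circle_mean_cong)
    fix z :: complex assume z: "norm z = 1"
    then have z0: "z \<noteq> 0"
      by auto
    have "norm (a * z) < 1" "norm (a / z) < 1"
      using z abcd(1) by (simp_all add: norm_mult norm_divide)
    then have nz: "1 - a * z \<noteq> 0" "1 - a / z \<noteq> 0"
      by (metis less_irrefl norm_one right_minus_eq)+
    have "?w' z = (1 - a * z) * (1 - a / z) * ?w z"
      using nz z0 by (simp add: aw_weight_def qpoch_pair_rec[OF q, of a z])
    moreover have "(1 - a * z) * (1 - a / z) = 1 + a\<^sup>2 - a * (z + 1 / z)"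
      using z0 by (simp add: field_simps power2_eq_square)
    ultimately show "(1 - a * b) * (1 - a * c) * (1 - a * d) * ?w z + - (1 - a * b * c * d) * ?w' z =
        - a * (?s z + ?s (1 / z))"
      unfolding aw_shift_symmetrized[OF q abcd z] by algebra
  qed
  also have "\<dots> = - a * (circle_mean ?s + circle_mean ?s)"
    by (simp only: circle_mean_mult circle_mean_add[OF cont_s cont_s'] circle_mean_inverse)
  also have "\<dots> = 0"
    by (simp add: circle_mean_aw_shift assms)
  also have "circle_mean (\<lambda>z. (1 - a * b) * (1 - a * c) * (1 - a * d) * ?w z + - (1 - a * b * c * d) * ?w' z) =
      (1 - a * b) * (1 - a * c) * (1 - a * d) * circle_mean ?w + - (1 - a * b * c * d) * circle_mean ?w'"
    by (subst circle_mean_add) (auto simp: circle_mean_mult intro!: continuous_intros cont_w cont_w')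
  finally show ?thesis
    unfolding aw_integral_def by algebra
qed

text \<open>\<open>G\<close> divides out the infinite products that iterating the recurrence
  generates, so that G (a q) = G a. Then G a = G (a q^n) for all n, and continuity of the integral
  in its parameter gives G a = G 0.\<close>

lemma aw_integral_to_0:
  assumes q: "norm q < 1" and abcd: "norm a < 1" "norm b < 1" "norm c < 1" "norm d < 1"
  shows "aw_integral q a b c d * (qpoch q (a * b) * qpoch q (a * c) * qpoch q (a * d)) =
    qpoch q (a * b * c * d) * aw_integral q 0 b c d"
proof -
  have m: "norm (x * y) < 1" if "norm x < 1" "norm y < 1" for x y :: complex
    using mult_strict_mono[of "norm x" 1 "norm y" 1] that by (simp add: norm_mult)
  define G where "G a = aw_integral q a b c d * (qpoch q (a * b) * qpoch q (a * c) * qpoch q (a * d)) /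
    qpoch q (a * b * c * d)" for a
  have G_rec: "G (a * q) = G a" if a: "norm a < 1" for a
  proof -
    have lt: "norm (a * b * c * d) < 1"
      by (intro m a abcd)
    have nz: "1 - a * b * c * d \<noteq> 0"
      using lt by (metis less_irrefl norm_one right_minus_eq)
    have nz': "qpoch q (a * b * c * d * q) \<noteq> 0"
      using qpoch_nonzero[OF q m[OF lt q]] .
    have r: "qpoch q (a * e) = (1 - a * e) * qpoch q (a * q * e)" for e
      using qpoch_rec[OF q, of "a * e"] by (simp add: mult_ac)
    have r4: "qpoch q (a * b * c * d) = (1 - a * b * c * d) * qpoch q (a * q * b * c * d)"
      using qpoch_rec[OF q, of "a * b * c * d"] by (simp add: mult_ac)
    have eq: "(1 - a * b * c * d) * aw_integral q (a * q) b c d =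
      (1 - a * b) * (1 - a * c) * (1 - a * d) * aw_integral q a b c d"
      using aw_integral_rec[OF q a abcd(2-4)] .
    have "G a = (1 - a * b) * (1 - a * c) * (1 - a * d) * aw_integral q a b c d *
        (qpoch q (a * q * b) * qpoch q (a * q * c) * qpoch q (a * q * d)) / ((1 - a * b * c * d) * qpoch q (a * q * b * c * d))"
      unfolding G_def r4 r[of b] r[of c] r[of d] by (simp only: mult_ac)
    also have "\<dots> = G (a * q)"
      unfolding G_def eq[symmetric] using nz nz' by (simp add: mult_ac)
    finally show ?thesis ..
  qed
  have G_pow: "G (a * q ^ n) = G a" for n
  proof (induction n)
    case (Suc n)
    have "norm (a * q ^ n) < 1"
      using m[OF abcd(1), of "q ^ n"] q abcd(1) by (cases "n = 0") (auto simp: norm_power power_less_one_iff)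
    then show ?case
      using G_rec[of "a * q ^ n"] Suc by (simp add: mult_ac)
  qed simp
  have "continuous_on (ball 0 1) G"
  proof -
    have "continuous_on (ball 0 1 \<times> cbox 0 (1::real)) (\<lambda>(a, t). aw_weight q a b c d (cis (2 * pi * t)))"
    proof -
      have "qpoch q (e * cis t) \<noteq> 0" "qpoch q (e / cis t) \<noteq> 0" if "norm e < 1" for e t
        using qpoch_nonzero[OF q, of "e * cis t"] qpoch_nonzero[OF q, of "e / cis t"] that
        by (simp_all add: norm_mult norm_divide)
      then show ?thesis
        unfolding aw_weight_def qpoch_pair_def case_prod_unfold using q abcd
        by (intro continuous_intros) auto
    qed
    then have "continuous_on (ball 0 1) (\<lambda>a. aw_integral q a b c d)"
      unfolding aw_integral_def circle_mean_def cbox_interval[symmetric]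
      by (rule integral_continuous_on_param)
    moreover have "qpoch q (a * b * c * d) \<noteq> 0" if "a \<in> ball 0 1" for a
      using that m abcd q by (intro qpoch_nonzero) auto
    ultimately show ?thesis
      unfolding G_def using q by (intro continuous_intros) auto
  qed
  then have "isCont G 0"
    by (simp add: continuous_on_eq_continuous_at)
  moreover have "(\<lambda>n. a * q ^ n) \<longlonglongrightarrow> 0"
    using LIMSEQ_power_zero[OF q] by (rule tendsto_mult_right_zero)
  ultimately have "(\<lambda>n. G (a * q ^ n)) \<longlonglongrightarrow> G 0"
    by (rule isCont_tendsto_compose)
  then have "G a = G 0"
    unfolding G_pow by (rule LIMSEQ_unique[OF tendsto_const])
  moreover have "qpoch q (a * b * c * d) \<noteq> 0"
    using m abcd q by (intro qpoch_nonzero) auto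
  ultimately show ?thesis
    by (simp add: G_def field_simps)
qed

section \<open>Evaluation of the integral\<close>

lemma aw_integral_perm:
  "aw_integral q a b c d = aw_integral q b a c d"
  "aw_integral q a b c d = aw_integral q c b a d"
  "aw_integral q a b c d = aw_integral q d b c a"
  unfolding aw_integral_def using aw_weight_perm[of q a b c d] by simp_all

text \<open>By symmetry each parameter can be moved to the first place and sent to 0. The pairs with
  a are collected first, then bc and bd, then cd; once three parameters are 0, the fourth leaves no
  factor.\<close>

lemma aw_integral_factor:
  assumes q: "norm q < 1" and abcd: "norm a < 1" "norm b < 1" "norm c < 1" "norm d < 1"
  shows "aw_integral q a b c d * (qpoch q (a * b) * qpoch q (a * c) * qpoch q (a * d) *
      qpoch q (b * c) * qpoch q (b * d) * qpoch q (c * d)) =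
    qpoch q (a * b * c * d) * aw_integral q 0 0 0 0"
proof -
  have 1: "aw_integral q 0 b c d * (qpoch q (b * c) * qpoch q (b * d)) = aw_integral q 0 0 c d"
    using aw_integral_to_0[OF q, of b 0 c d] abcd aw_integral_perm(1)[of q 0 b c d] by simp
  have 2: "aw_integral q 0 0 c d * qpoch q (c * d) = aw_integral q 0 0 0 d"
    using aw_integral_to_0[OF q, of c 0 0 d] abcd aw_integral_perm(2)[of q 0 0 c d] by simp
  have 3: "aw_integral q 0 0 0 d = aw_integral q 0 0 0 0"
    using aw_integral_to_0[OF q, of d 0 0 0] abcd aw_integral_perm(3)[of q 0 0 0 d] by simp
  show ?thesis
    using aw_integral_to_0[OF q abcd] 1 2 3 by algebra
qed

lemma aw_integral_0:
  assumes q: "norm q < 1"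
  shows "qpoch q q * aw_integral q 0 0 0 0 = 2"
proof -
  \<comment> \<open>for the parameters \<open>s, - s, q, - q\<close> the weight collapses to \<open>(1 - z\<^sup>2) (1 - 1 / z\<^sup>2)\<close>\<close>
  define s where "s = csqrt q"
  have s2: "s\<^sup>2 = q"
    by (simp add: s_def)
  have q2: "norm (q\<^sup>2) < 1"
    using q by (simp add: norm_power abs_square_less_1)
  have s: "norm s < 1"
    using q by (simp add: s_def)
  have sq: "norm (s * q) < 1"
    using mult_strict_mono[of "norm s" 1 "norm q" 1] s q by (simp add: norm_mult)
  \<comment> \<open>Even and odd exponents are separated; each half is then factored as a difference
    of squares, with square roots y of x and u of x q.\<close>
  have pair: "qpoch q x = qpoch q y * qpoch q (- y) * (qpoch q u * qpoch q (- u))" if "y\<^sup>2 = x" "u\<^sup>2 = x * q" for x y u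
    using qpoch_split_even_odd[OF q, of x] qpoch_square_base[OF q, of y] qpoch_square_base[OF q, of u] that by simp
  have "aw_integral q s (- s) q (- q) = circle_mean (\<lambda>z. (2 + - 1 * z\<^sup>2) + - 1 * (1 / z)\<^sup>2)"
    unfolding aw_integral_def
  proof (rule circle_mean_cong)
    fix z :: complex assume z: "norm z = 1"
    then have z0: "z \<noteq> 0" by auto
    have 1: "qpoch q (q * z\<^sup>2) = qpoch q (s * z) * qpoch q (- (s * z)) * (qpoch q (q * z) * qpoch q (- (q * z)))"
    proof (rule pair)
      show "(s * z)\<^sup>2 = q * z\<^sup>2"
        by (simp add: power_mult_distrib s2)
      show "(q * z)\<^sup>2 = q * z\<^sup>2 * q"
        by (simp add: power2_eq_square)
    qed
    have 2: "qpoch q (q / z\<^sup>2) = qpoch q (s / z) * qpoch q (- (s / z)) * (qpoch q (q / z) * qpoch q (- (q / z)))"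
    proof (rule pair)
      show "(s / z)\<^sup>2 = q / z\<^sup>2"
        by (simp add: power_divide s2)
      show "(q / z)\<^sup>2 = q / z\<^sup>2 * q"
        by (simp add: power2_eq_square)
    qed
    have nz: "qpoch q (q * z\<^sup>2) \<noteq> 0" "qpoch q (q / z\<^sup>2) \<noteq> 0"
      using qpoch_nonzero[OF q, of "q * z\<^sup>2"] qpoch_nonzero[OF q, of "q / z\<^sup>2"] z q
      by (simp_all add: norm_mult norm_divide norm_power)
    have "aw_weight q s (- s) q (- q) z = qpoch q (z\<^sup>2) * qpoch q (1 / z\<^sup>2) / (qpoch q (q * z\<^sup>2) * qpoch q (q / z\<^sup>2))"
      unfolding aw_weight_def qpoch_pair_def 1 2 by (simp add: mult_ac)
    also have "\<dots> = (1 - z\<^sup>2) * (1 - (1 / z)\<^sup>2)"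
      using nz qpoch_rec[OF q, of "z\<^sup>2"] qpoch_rec[OF q, of "1 / z\<^sup>2"] by (simp add: mult_ac power_divide)
    also have "\<dots> = (2 + - 1 * z\<^sup>2) + - 1 * (1 / z)\<^sup>2"
      using z0 by (simp add: field_simps power2_eq_square)
    finally show "aw_weight q s (- s) q (- q) z = (2 + - 1 * z\<^sup>2) + - 1 * (1 / z)\<^sup>2" .
  qed
  also have "\<dots> = circle_mean (\<lambda>z. 2 + - 1 * z\<^sup>2) + - 1 * circle_mean (\<lambda>z. z\<^sup>2)"
    using circle_mean_inverse[of "\<lambda>z. z\<^sup>2"] circle_mean_mult[of "- 1" "\<lambda>z. (1 / z)\<^sup>2"]
    by (subst circle_mean_add) (auto intro!: continuous_intros)
  also have "circle_mean (\<lambda>z. 2 + - 1 * z\<^sup>2) = 2"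
    by (subst circle_mean_holomorphic[of UNIV]) (auto intro!: holomorphic_intros)
  also have "circle_mean (\<lambda>z. z\<^sup>2) = 0"
    by (subst circle_mean_holomorphic[of UNIV]) (auto intro!: holomorphic_intros)
  finally have "aw_integral q s (- s) q (- q) = 2" by simp
  moreover have "s * - s = - q" "s * - q = - (s * q)" "- s * - q = s * q" "q * - q = - q\<^sup>2"
      "s * - s * q * - q = q ^ 3"
    using s2 by (simp_all add: power2_eq_square power3_eq_cube)
  ultimately have eq: "2 * (qpoch q (- q) * qpoch q (s * q) * qpoch q (- (s * q)) * qpoch q (- (s * q)) * qpoch q (s * q) *
      qpoch q (- q\<^sup>2)) = qpoch q (q ^ 3) * aw_integral q 0 0 0 0"
    using aw_integral_factor[OF q, of s "- s" q "- q"] s q by simp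
  \<comment> \<open>In base q^2 the square root s disappears, since (s q)^2 = q^3, and the remaining
    symbols are tied together by the two factorisations.\<close>
  define A where "A = qpoch (q\<^sup>2) (q ^ 3)"
  define B where "B = qpoch (q\<^sup>2) (q\<^sup>2)"
  define B' where "B' = qpoch (q\<^sup>2) (q ^ 4)"
  have A: "qpoch q (s * q) * qpoch q (- (s * q)) = A"
  proof -
    have "(s * q)\<^sup>2 = q ^ 3"
      unfolding power_mult_distrib s2 by (simp add: power2_eq_square power3_eq_cube)
    then show ?thesis
      using qpoch_square_base[OF q, of "s * q"] by (simp add: A_def)
  qed
  have AB: "qpoch q (q ^ 3) = A * B'"
    using qpoch_split_even_odd[OF q, of "q ^ 3"] by (simp add: A_def B'_def power_Suc2[symmetric] del: power_Suc)
  have B: "B = qpoch q q * qpoch q (- q)"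
    using qpoch_square_base[OF q, of q] by (simp add: B_def)
  have B': "B' = qpoch q (q\<^sup>2) * qpoch q (- q\<^sup>2)"
    using qpoch_square_base[OF q, of "q\<^sup>2"] by (simp add: B'_def)
  have BA: "qpoch q (q\<^sup>2) = B * A"
    using qpoch_split_even_odd[OF q, of "q\<^sup>2"] by (simp add: A_def B_def power2_eq_square power3_eq_cube)
  have nz: "qpoch q (q\<^sup>2) \<noteq> 0" "A \<noteq> 0" "B \<noteq> 0" "B' \<noteq> 0"
    unfolding A_def B_def B'_def using q q2
    by (simp_all add: qpoch_nonzero norm_power power_less_one_iff)
  \<comment> \<open>After multiplication by A B' B the claim follows from the relations without any
    division; the nonzero factor is cancelled at the end.\<close>
  have "qpoch q q * aw_integral q 0 0 0 0 * (A * (B' * B)) = 2 * (A * (B' * B))"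
    using eq A AB B B' BA by algebra
  then show ?thesis
    using nz by simp
qed

text \<open>The constant 2 is due to averaging over the whole circle, which covers 0 <= theta <= pi
  twice.\<close>

theorem askey_wilson_integral:
  assumes "norm q < 1" "norm a < 1" "norm b < 1" "norm c < 1" "norm d < 1"
  shows "aw_integral q a b c d * (qpoch q q * qpoch q (a * b) * qpoch q (a * c) * qpoch q (a * d) *
      qpoch q (b * c) * qpoch q (b * d) * qpoch q (c * d)) = 2 * qpoch q (a * b * c * d)"
  using aw_integral_factor[OF assms] aw_integral_0[OF assms(1)] by algebra

section \<open>The densities in the variable theta\<close>

definition rpoch :: "real \<Rightarrow> real \<Rightarrow> real" where
  "rpoch q a = (\<Prod>k. 1 - a * q ^ k)"

lemma convergent_prod_rpoch:
  assumes "\<bar>q\<bar> < 1"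
  shows "convergent_prod (\<lambda>k. 1 - a * q ^ k :: real)"
  by (rule convergent_prod_geometric[where C = "\<bar>a\<bar>" and q = q]) (use assms in \<open>simp_all add: abs_mult\<close>)

lemma of_real_rpoch:
  assumes "\<bar>q\<bar> < 1"
  shows "complex_of_real (rpoch q a) = qpoch (of_real q) (of_real a)"
proof -
  have "(\<lambda>k. 1 - a * q ^ k) has_prod rpoch q a"
    unfolding rpoch_def using convergent_prod_rpoch[OF assms] by blast
  then have "(\<lambda>k. complex_of_real (1 - a * q ^ k)) has_prod complex_of_real (rpoch q a)"
    by (simp only: has_prod_of_real_iff)
  then show ?thesis
    by (simp add: qpoch_def has_prod_iff)
qed

lemma rpoch_pos:
  assumes "\<bar>q\<bar> < 1" "\<bar>a\<bar> < 1"
  shows "rpoch q a > 0"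
proof (rule has_prod_pos)
  show "(\<lambda>k. 1 - a * q ^ k) has_prod rpoch q a"
    unfolding rpoch_def using convergent_prod_rpoch[OF assms(1)] by blast
  show "1 - a * q ^ k > 0" for k
  proof -
    have "\<bar>a\<bar> * \<bar>q\<bar> ^ k \<le> \<bar>a\<bar> * 1"
      using assms by (intro mult_left_mono power_le_one) auto
    then have "\<bar>a * q ^ k\<bar> < 1"
      using assms(2) by (simp add: abs_mult power_abs)
    then show ?thesis by linarith
  qed
qed

text \<open>For real q this is the product of the symbols at a and at \<open>cnj a\<close>; as a
  squared modulus it is visibly real and nonnegative.\<close>

definition npoch :: "real \<Rightarrow> complex \<Rightarrow> real" where
  "npoch q a = (norm (qpoch (of_real q) a))\<^sup>2"

lemma has_prod_npoch:
  assumes "\<bar>q\<bar> < 1"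
  shows "(\<lambda>k. (norm (1 - a * complex_of_real q ^ k))\<^sup>2) has_prod npoch q a"
proof -
  have "(\<lambda>k. 1 - a * of_real q ^ k) has_prod qpoch (of_real q) a"
    unfolding qpoch_def using convergent_prod_qpoch[of "of_real q" a] assms by auto
  then show ?thesis
    unfolding npoch_def by (intro has_prod_power has_prod_norm)
qed

lemma npoch_pos:
  assumes "\<bar>q\<bar> < 1" "norm a < 1"
  shows "npoch q a > 0"
  unfolding npoch_def using qpoch_nonzero[of "of_real q" a] assms by simp

lemma complex_of_real_npoch:
  assumes "\<bar>q\<bar> < 1"
  shows "complex_of_real (npoch q a) = qpoch (of_real q) a * qpoch (of_real q) (cnj a)"
  unfolding npoch_def using qpoch_cnj[of "of_real q" a] assms
  by (simp add: complex_norm_square del: of_real_power)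

lemma npoch_cnj:
  assumes "\<bar>q\<bar> < 1"
  shows "npoch q (cnj a) = npoch q a"
  unfolding npoch_def using qpoch_cnj[of "of_real q" a] assms by simp

lemma norm_one_minus_cis:
  "(norm (1 - complex_of_real r * cis \<theta>))\<^sup>2 = 1 - 2 * r * cos \<theta> + r\<^sup>2"
proof -
  have "(norm (1 - complex_of_real r * cis \<theta>))\<^sup>2 = (1 - r * cos \<theta>)\<^sup>2 + (r * sin \<theta>)\<^sup>2"
    by (simp add: cmod_power2)
  also have "\<dots> = 1 - 2 * r * cos \<theta> + r\<^sup>2 * ((sin \<theta>)\<^sup>2 + (cos \<theta>)\<^sup>2)"
    by algebra
  finally show ?thesis by simp
qed

text \<open>The substitution \<open>x = 2 cos \<theta> / sqrt (1 - q)\<close> parametrises \<^term>\<open>qS q\<close>.\<close>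

definition qx :: "real \<Rightarrow> real \<Rightarrow> real" where
  "qx q \<theta> = 2 * cos \<theta> / sqrt (1 - q)"

lemma qx_in_qS:
  assumes "q < 1"
  shows "qx q \<theta> \<in> qS q"
  using assms cos_le_one[of \<theta>] cos_ge_minus_one[of \<theta>]
  by (auto simp: qx_def qS_def field_simps)

lemma qx_square:
  assumes "q < 1"
  shows "(1 - q) * (qx q \<theta> * qx q \<phi>) = 4 * (cos \<theta> * cos \<phi>)"
  using assms by (simp add: qx_def)

lemma qS_bounds:
  assumes "q < 1" "x \<in> qS q"
  shows "- 1 \<le> x * sqrt (1 - q) / 2" "x * sqrt (1 - q) / 2 \<le> 1"
  using assms by (auto simp: qS_def field_simps)

lemma qx_arccos:
  assumes "q < 1" "x \<in> qS q"
  shows "qx q (arccos (x * sqrt (1 - q) / 2)) = x"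
  using assms qS_bounds[OF assms] by (simp add: qx_def)

text \<open>Since (1 - q) x^2 = 2 (cos (2 theta) + 1), each factor of the first product is the
  squared modulus of 1 - q^k exp (2 i theta). At sin theta = 0 both sides are 0 by division by
  zero.\<close>

lemma fN_qx:
  assumes "\<bar>q\<bar> < 1"
  shows "fN q (qx q \<theta>) = sqrt (1 - q) / (4 * pi * \<bar>sin \<theta>\<bar>) * npoch q (cis (2 * \<theta>)) * rpoch q q"
proof -
  have fac: "(1 + q ^ k)\<^sup>2 - (1 - q) * (qx q \<theta>)\<^sup>2 * q ^ k = (norm (1 - cis (2 * \<theta>) * complex_of_real q ^ k))\<^sup>2" for k
  proof -
    have "(1 - q) * (qx q \<theta>)\<^sup>2 = 2 * (cos (2 * \<theta>) + 1)"
      using qx_square[of q \<theta> \<theta>] assms by (simp add: cos_double_cos power2_eq_square)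
    then have "(1 + r)\<^sup>2 - (1 - q) * (qx q \<theta>)\<^sup>2 * r = 1 - 2 * r * cos (2 * \<theta>) + r\<^sup>2" for r
      by algebra
    then show ?thesis
      using norm_one_minus_cis[of "q ^ k" "2 * \<theta>"] by (simp add: mult.commute[of "cis _"])
  qed
  have "(\<Prod>k. (1 + q ^ k)\<^sup>2 - (1 - q) * (qx q \<theta>)\<^sup>2 * q ^ k) = npoch q (cis (2 * \<theta>))"
    unfolding fac using has_prod_npoch[OF assms] by (simp add: has_prod_iff)
  moreover have "(\<Prod>k. 1 - q ^ (k + 1)) = rpoch q q"
    by (simp add: rpoch_def)
  moreover have "sqrt (4 - (1 - q) * (qx q \<theta>)\<^sup>2) = 2 * \<bar>sin \<theta>\<bar>"
  proof -
    have "4 - (1 - q) * (qx q \<theta>)\<^sup>2 = (2 * sin \<theta>)\<^sup>2"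
      using qx_square[of q \<theta> \<theta>] assms by (simp add: power2_eq_square sin_squared_eq[unfolded power2_eq_square])
    then show ?thesis
      by (simp add: real_sqrt_mult)
  qed
  moreover have "qx q \<theta> \<in> qS q" "q \<noteq> 1"
    using assms by (auto intro: qx_in_qS)
  ultimately show ?thesis
    by (simp add: fN_def)
qed

lemma fN_nonneg:
  assumes "- 1 < q" "q \<le> 1"
  shows "fN q x \<ge> 0"
proof (cases "q = 1 \<or> x \<notin> qS q")
  case False
  then have q: "\<bar>q\<bar> < 1" using assms by auto
  have "fN q (qx q (arccos (x * sqrt (1 - q) / 2))) \<ge> 0"
    unfolding fN_qx[OF q] using rpoch_pos[OF q q] q
    by (intro mult_nonneg_nonneg divide_nonneg_nonneg) (auto simp: npoch_def)
  then show ?thesis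
    using qx_arccos[of q x] False q by simp
qed (auto simp: fN_def)

text \<open>The Poisson-Mehler kernel of the continuous q-Hermite polynomials. Its symmetry in x and
  y expresses the reversibility of the chain.\<close>

definition mehler :: "real \<Rightarrow> real \<Rightarrow> real \<Rightarrow> real \<Rightarrow> real" where
  "mehler q \<rho> y x = (\<Prod>k. (1 - \<rho>\<^sup>2 * q ^ k) /
     ((1 - \<rho>\<^sup>2 * q ^ (2 * k))\<^sup>2
      - (1 - q) * \<rho> * q ^ k * (1 + \<rho>\<^sup>2 * q ^ (2 * k)) * x * y
      + (1 - q) * \<rho>\<^sup>2 * (x\<^sup>2 + y\<^sup>2) * q ^ (2 * k)))"

lemma fCN_eq_mehler: "q \<noteq> 1 \<Longrightarrow> fCN q \<rho> y x = fN q x * mehler q \<rho> y x"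
  by (simp add: fCN_def mehler_def)

lemma mehler_commute: "mehler q \<rho> x y = mehler q \<rho> y x"
  by (simp add: mehler_def mult_ac add.commute)

text \<open>The four symbols at rho exp (i (+-phi +- theta)), grouped into two conjugate
  pairs.\<close>

definition wpoch :: "real \<Rightarrow> real \<Rightarrow> real \<Rightarrow> real \<Rightarrow> real" where
  "wpoch q \<rho> \<phi> \<theta> = npoch q (of_real \<rho> * cis (\<phi> + \<theta>)) * npoch q (of_real \<rho> * cis (\<phi> - \<theta>))"

lemma wpoch_pos:
  assumes "\<bar>q\<bar> < 1" "\<bar>\<rho>\<bar> < 1"
  shows "wpoch q \<rho> \<phi> \<theta> > 0"
  unfolding wpoch_def using assms by (intro mult_pos_pos npoch_pos) (auto simp: norm_mult)

text \<open>With r = rho q^k each denominator, of degree 4 in r, splits into 1 - 2 r cos (phi +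
  theta) + r^2 and 1 - 2 r cos (phi - theta) + r^2, and both are squared moduli.\<close>

lemma mehler_qx:
  assumes "\<bar>q\<bar> < 1" "\<bar>\<rho>\<bar> < 1"
  shows "mehler q \<rho> (qx q \<phi>) (qx q \<theta>) = rpoch q (\<rho>\<^sup>2) / wpoch q \<rho> \<phi> \<theta>"
proof -
  have fac: "(1 - \<rho>\<^sup>2 * q ^ (2 * k))\<^sup>2
      - (1 - q) * \<rho> * q ^ k * (1 + \<rho>\<^sup>2 * q ^ (2 * k)) * qx q \<theta> * qx q \<phi>
      + (1 - q) * \<rho>\<^sup>2 * ((qx q \<theta>)\<^sup>2 + (qx q \<phi>)\<^sup>2) * q ^ (2 * k) =
    (norm (1 - (of_real \<rho> * cis (\<phi> + \<theta>)) * complex_of_real q ^ k))\<^sup>2 *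
    (norm (1 - (of_real \<rho> * cis (\<phi> - \<theta>)) * complex_of_real q ^ k))\<^sup>2" (is "?l = ?r") for k
  proof -
    define r where "r = \<rho> * q ^ k"
    have r2: "r\<^sup>2 = \<rho>\<^sup>2 * q ^ (2 * k)"
      by (simp add: r_def power_mult_distrib power_mult[symmetric] mult.commute[of k])
    have s: "(sin \<theta>)\<^sup>2 + (cos \<theta>)\<^sup>2 = 1" "(sin \<phi>)\<^sup>2 + (cos \<phi>)\<^sup>2 = 1"
      by simp_all
    have sq: "(1 - q) * (qx q \<theta>)\<^sup>2 = 4 * (cos \<theta>)\<^sup>2" "(1 - q) * (qx q \<phi>)\<^sup>2 = 4 * (cos \<phi>)\<^sup>2"
       "(1 - q) * (qx q \<theta> * qx q \<phi>) = 4 * (cos \<theta> * cos \<phi>)"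
      using assms qx_square[of q] by (simp_all add: power2_eq_square)
    have "?l = (1 - r\<^sup>2)\<^sup>2 - r * (1 + r\<^sup>2) * ((1 - q) * (qx q \<theta> * qx q \<phi>))
       + r\<^sup>2 * ((1 - q) * (qx q \<theta>)\<^sup>2 + (1 - q) * (qx q \<phi>)\<^sup>2)"
    proof -
      have "(1 - q) * \<rho> * q ^ k * (1 + r\<^sup>2) * qx q \<theta> * qx q \<phi> = r * (1 + r\<^sup>2) * ((1 - q) * (qx q \<theta> * qx q \<phi>))"
        by (simp add: r_def)
      moreover have "(1 - q) * \<rho>\<^sup>2 * ((qx q \<theta>)\<^sup>2 + (qx q \<phi>)\<^sup>2) * q ^ (2 * k) =
          r\<^sup>2 * ((1 - q) * (qx q \<theta>)\<^sup>2 + (1 - q) * (qx q \<phi>)\<^sup>2)"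
        unfolding r2 by (simp add: algebra_simps)
      ultimately show ?thesis
        unfolding r2[symmetric] by simp
    qed
    also have "\<dots> = (1 - r\<^sup>2)\<^sup>2 - 4 * r * (1 + r\<^sup>2) * (cos \<theta> * cos \<phi>) + 4 * r\<^sup>2 * ((cos \<theta>)\<^sup>2 + (cos \<phi>)\<^sup>2)"
      unfolding sq by algebra
    also have "\<dots> = (1 - 2 * r * cos (\<phi> + \<theta>) + r\<^sup>2) * (1 - 2 * r * cos (\<phi> - \<theta>) + r\<^sup>2)"
      unfolding cos_add cos_diff using s by algebra
    also have "\<dots> = (norm (1 - complex_of_real r * cis (\<phi> + \<theta>)))\<^sup>2 * (norm (1 - complex_of_real r * cis (\<phi> - \<theta>)))\<^sup>2"
      by (simp only: norm_one_minus_cis)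
    also have "\<dots> = ?r"
      by (simp add: r_def mult_ac)
    finally show ?thesis .
  qed
  have 1: "(\<lambda>k. 1 - \<rho>\<^sup>2 * q ^ k) has_prod rpoch q (\<rho>\<^sup>2)"
    unfolding rpoch_def using convergent_prod_rpoch[OF assms(1)] by blast
  have 2: "(\<lambda>k. (norm (1 - (of_real \<rho> * cis (\<phi> + \<theta>)) * complex_of_real q ^ k))\<^sup>2 *
    (norm (1 - (of_real \<rho> * cis (\<phi> - \<theta>)) * complex_of_real q ^ k))\<^sup>2) has_prod wpoch q \<rho> \<phi> \<theta>"
    unfolding wpoch_def by (intro has_prod_mult has_prod_npoch assms(1))
  show ?thesis
    unfolding mehler_def fac using has_prod_divide[OF 1 2] by (simp add: has_prod_iff)
qed

lemma mehler_nonneg: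
  assumes "\<bar>q\<bar> < 1" "\<bar>\<rho>\<bar> < 1" "x \<in> qS q" "y \<in> qS q"
  shows "mehler q \<rho> y x \<ge> 0"
proof -
  have "\<rho>\<^sup>2 < 1"
    using assms(2) by (simp add: abs_square_less_1)
  then have "mehler q \<rho> (qx q \<phi>) (qx q \<theta>) \<ge> 0" for \<phi> \<theta>
    using assms wpoch_pos[OF assms(1,2)] rpoch_pos[OF assms(1), of "\<rho>\<^sup>2"]
    by (simp add: mehler_qx less_imp_le)
  then show ?thesis
    using qx_arccos[of q x] qx_arccos[of q y] assms by (metis abs_less_iff)
qed

lemma continuous_on_npoch [continuous_intros]:
  assumes "\<bar>q\<bar> < 1" "continuous_on A f"
  shows "continuous_on A (\<lambda>x. npoch q (f x))"
  unfolding npoch_def using assms by (intro continuous_intros) auto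

lemma continuous_on_wpoch [continuous_intros]:
  assumes "\<bar>q\<bar> < 1" "continuous_on A f"
  shows "continuous_on A (\<lambda>x. wpoch q \<rho> \<phi> (f x))"
  unfolding wpoch_def using assms by (intro continuous_intros) auto

lemma npoch_cis_minus:
  assumes "\<bar>q\<bar> < 1"
  shows "npoch q (of_real \<rho> * cis (- \<theta>)) = npoch q (of_real \<rho> * cis \<theta>)"
  using npoch_cnj[OF assms, of "of_real \<rho> * cis \<theta>"] by (simp add: cis_cnj)

lemma wpoch_minus: "wpoch q \<rho> \<phi> (- \<theta>) = wpoch q \<rho> \<phi> \<theta>"
  by (simp add: wpoch_def mult.commute)

lemma wpoch_qpoch:
  assumes "\<bar>q\<bar> < 1"
  shows "complex_of_real (wpoch q \<rho> \<phi> \<theta>) =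
    qpoch q (\<rho> * cis \<phi> * cis \<theta>) * qpoch q (\<rho> * cis (- \<phi>) * cis (- \<theta>)) *
    qpoch q (\<rho> * cis \<phi> * cis (- \<theta>)) * qpoch q (\<rho> * cis (- \<phi>) * cis \<theta>)"
  by (simp add: wpoch_def complex_of_real_npoch[OF assms] cis_cnj mult.assoc cis_mult)

lemma aw_weight_cis:
  assumes "\<bar>q\<bar> < 1"
  shows "aw_weight q (\<rho>\<^sub>1 * cis \<phi>) (\<rho>\<^sub>1 * cis (- \<phi>)) (\<rho>\<^sub>2 * cis \<psi>) (\<rho>\<^sub>2 * cis (- \<psi>)) (cis \<theta>) =
    complex_of_real (npoch q (cis (2 * \<theta>)) / (wpoch q \<rho>\<^sub>1 \<phi> \<theta> * wpoch q \<rho>\<^sub>2 \<psi> \<theta>))"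
proof -
  have 1: "(cis \<theta>)\<^sup>2 = cis (2 * \<theta>)" "1 / cis (2 * \<theta>) = cnj (cis (2 * \<theta>))"
    by (simp_all add: power2_eq_square cis_mult cis_cnj divide_inverse)
  have 2: "a / cis \<theta> = a * cis (- \<theta>)" for a
    by (simp add: divide_inverse)
  show ?thesis
    unfolding aw_weight_def qpoch_pair_def 1 2
    by (simp add: wpoch_qpoch[OF assms] complex_of_real_npoch[OF assms] mult_ac)
qed

lemma integral_npoch_wpoch:
  assumes q: "\<bar>q\<bar> < 1" and \<rho>: "\<bar>\<rho>\<^sub>1\<bar> < 1" "\<bar>\<rho>\<^sub>2\<bar> < 1"
  shows "rpoch q q * rpoch q (\<rho>\<^sub>1\<^sup>2) * rpoch q (\<rho>\<^sub>2\<^sup>2) * wpoch q (\<rho>\<^sub>1 * \<rho>\<^sub>2) \<phi> \<psi> *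
    integral {0..1} (\<lambda>t. npoch q (cis (2 * (2 * pi * t))) / (wpoch q \<rho>\<^sub>1 \<phi> (2 * pi * t) * wpoch q \<rho>\<^sub>2 \<psi> (2 * pi * t))) =
    2 * rpoch q ((\<rho>\<^sub>1 * \<rho>\<^sub>2)\<^sup>2)" (is "_ * integral _ ?f = _")
proof -
  let ?a = "complex_of_real \<rho>\<^sub>1 * cis \<phi>" and ?b = "complex_of_real \<rho>\<^sub>1 * cis (- \<phi>)"
  let ?c = "complex_of_real \<rho>\<^sub>2 * cis \<psi>" and ?d = "complex_of_real \<rho>\<^sub>2 * cis (- \<psi>)"
  have "?f integrable_on {0..1}"
  proof -
    have "wpoch q \<rho>\<^sub>1 \<phi> \<theta> * wpoch q \<rho>\<^sub>2 \<psi> \<theta> \<noteq> 0" for \<theta>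
      using wpoch_pos[OF q \<rho>(1), of \<phi> \<theta>] wpoch_pos[OF q \<rho>(2), of \<psi> \<theta>] by simp
    then show ?thesis
      using q by (intro integrable_continuous_real continuous_intros) auto
  qed
  then have "(?f has_integral integral {0..1} ?f) {0..1}"
    by (rule integrable_integral)
  then have "((\<lambda>t. complex_of_real (?f t)) has_integral complex_of_real (integral {0..1} ?f)) {0..1}"
    by (rule has_integral_of_real)
  then have "aw_integral q ?a ?b ?c ?d = complex_of_real (integral {0..1} ?f)"
    unfolding aw_integral_def circle_mean_def aw_weight_cis[OF q] by (rule integral_unique)
  moreover have "norm ?a < 1" "norm ?b < 1" "norm ?c < 1" "norm ?d < 1" "norm (complex_of_real q) < 1"
    using assms by (simp_all add: norm_mult)
  moreover have "?a * ?b = complex_of_real (\<rho>\<^sub>1\<^sup>2)" "?c * ?d = complex_of_real (\<rho>\<^sub>2\<^sup>2)"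
    "?a * ?b * ?c * ?d = complex_of_real ((\<rho>\<^sub>1 * \<rho>\<^sub>2)\<^sup>2)"
    by (simp_all add: cis_mult power2_eq_square mult_ac)
  moreover have "complex_of_real (wpoch q (\<rho>\<^sub>1 * \<rho>\<^sub>2) \<phi> \<psi>) =
     qpoch q (?a * ?c) * qpoch q (?b * ?d) * qpoch q (?a * ?d) * qpoch q (?b * ?c)"
    by (simp add: wpoch_qpoch[OF q] mult_ac)
  ultimately have "complex_of_real (integral {0..1} ?f) * (complex_of_real (rpoch q q) * complex_of_real (rpoch q (\<rho>\<^sub>1\<^sup>2)) *
      complex_of_real (rpoch q (\<rho>\<^sub>2\<^sup>2)) * complex_of_real (wpoch q (\<rho>\<^sub>1 * \<rho>\<^sub>2) \<phi> \<psi>)) =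
      2 * complex_of_real (rpoch q ((\<rho>\<^sub>1 * \<rho>\<^sub>2)\<^sup>2))"
    using askey_wilson_integral[of q ?a ?b ?c ?d] unfolding of_real_rpoch[OF q] by (simp add: mult_ac)
  then have "complex_of_real (integral {0..1} ?f * (rpoch q q * rpoch q (\<rho>\<^sub>1\<^sup>2) * rpoch q (\<rho>\<^sub>2\<^sup>2) * wpoch q (\<rho>\<^sub>1 * \<rho>\<^sub>2) \<phi> \<psi>)) =
      complex_of_real (2 * rpoch q ((\<rho>\<^sub>1 * \<rho>\<^sub>2)\<^sup>2))"
    by (simp only: of_real_mult of_real_numeral)
  then show ?thesis
    unfolding of_real_eq_iff by (simp add: mult_ac)
qed

section \<open>From the circle back to the real line\<close>

lemma integral_double:
  fixes f :: "real \<Rightarrow> real"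
  assumes "continuous_on {0..1} f" "\<And>t. f (1 - t) = f t"
  shows "integral {0..1} f = 2 * integral {1/2..1} f"
proof -
  have int: "f integrable_on {1/2..1}" "f integrable_on {0..1}"
    by (intro integrable_continuous_real continuous_on_subset[OF assms(1)]; auto)+
  have "(f has_integral integral {1/2..1} f) (cbox (1/2) 1)"
    using int(1) by (simp add: integrable_integral)
  from has_integral_affinity[OF this, of "-1" 1]
  have "((\<lambda>t. f (1 - t)) has_integral integral {1/2..1} f) ((\<lambda>x. 1 - x) ` {1/2..1})"
    by simp
  moreover have "(\<lambda>x::real. 1 - x) ` {1/2..1} = {0..1/2}"
    by (subst image_diff_atLeastAtMost) simp
  ultimately have "integral {0..1/2} f = integral {1/2..1} f"
    using assms(2) by (simp add: integral_unique)
  then show ?thesis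
    using Henstock_Kurzweil_Integration.integral_combine[of 0 "1/2" 1 f] int by simp
qed

text \<open>In the variable theta = arccos (x sqrt (1 - q) / 2) the kernel is a constant divided by
  a continuous positive function.\<close>

lemma continuous_on_mehler:
  assumes q: "\<bar>q\<bar> < 1" and "\<bar>\<rho>\<bar> < 1" "y \<in> qS q"
  shows "continuous_on (qS q) (mehler q \<rho> y)"
proof -
  let ?\<theta> = "\<lambda>x. arccos (x * sqrt (1 - q) / 2)"
  have w: "wpoch q \<rho> \<phi> \<theta> \<noteq> 0" for \<phi> \<theta>
    using wpoch_pos[OF assms(1,2)] by (metis less_irrefl)
  have "continuous_on (qS q) ?\<theta>"
    using q by (intro continuous_intros) (auto dest: qS_bounds[rotated])
  then have "continuous_on (qS q) (\<lambda>x. rpoch q (\<rho>\<^sup>2) / wpoch q \<rho> (?\<theta> y) (?\<theta> x))"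
    using q by (intro continuous_on_divide continuous_on_const continuous_on_wpoch) (auto simp: w)
  moreover have "rpoch q (\<rho>\<^sup>2) / wpoch q \<rho> (?\<theta> y) (?\<theta> x) = mehler q \<rho> y x" if "x \<in> qS q" for x
    using mehler_qx[OF assms(1,2), of "?\<theta> y" "?\<theta> x"] qx_arccos[of q] that assms by simp
  ultimately show ?thesis
    by (simp cong: continuous_on_cong)
qed

lemma qS_borel [measurable]: "qS q \<in> sets borel"
  by (simp add: qS_def)

lemma borel_measurable_mehler:
  assumes "\<bar>q\<bar> < 1" "\<bar>\<rho>\<bar> < 1" "y \<in> qS q"
  shows "(\<lambda>x. indicator (qS q) x * mehler q \<rho> y x) \<in> borel_measurable borel"
  using borel_measurable_continuous_on_indicator[OF qS_borel continuous_on_mehler[OF assms]] by simp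

lemma borel_measurable_fN:
  assumes "- 1 < q" "q \<le> 1"
  shows "fN q \<in> borel_measurable borel"
proof (cases "q = 1")
  case False
  then have q: "\<bar>q\<bar> < 1" using assms by auto
  let ?\<theta> = "\<lambda>x. arccos (x * sqrt (1 - q) / 2)"
  have "continuous_on (qS q) (\<lambda>x. npoch q (cis (2 * ?\<theta> x)))"
    using q by (intro continuous_intros) (auto dest: qS_bounds[rotated])
  note m = borel_measurable_continuous_on_indicator[OF qS_borel this]
  have "continuous_on (qS q) (\<lambda>x. \<bar>sin (?\<theta> x)\<bar>)"
    using q by (intro continuous_intros) (auto dest: qS_bounds[rotated])
  note s = borel_measurable_continuous_on_indicator[OF qS_borel this]
  \<comment> \<open>Outside \<open>qS q\<close> the indicator in the denominator makes the
    right-hand side 0 by division by zero. Each varying piece is thus a continuous function on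
    \<open>qS q\<close> extended by 0.\<close>
  have eq: "fN q x = sqrt (1 - q) / (4 * pi * (indicator (qS q) x *\<^sub>R \<bar>sin (?\<theta> x)\<bar>)) *
      (indicator (qS q) x *\<^sub>R npoch q (cis (2 * ?\<theta> x))) * rpoch q q" for x
  proof (cases "x \<in> qS q")
    case True
    then show ?thesis
      using fN_qx[OF q, of "?\<theta> x"] qx_arccos[of q x] q by simp
  qed (use False in \<open>simp add: fN_def\<close>)
  show ?thesis
    unfolding eq[abs_def]
    by (intro borel_measurable_times borel_measurable_divide borel_measurable_const m s)
qed (simp add: fN_1)

text \<open>The Chapman-Kolmogorov equation of the kernels relative to \<open>fN\<close>. Without a
  factor \<open>fN q z\<close> it stays informative where that factor would vanish.\<close>

lemma nn_integral_fN_mehler: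
  assumes q: "\<bar>q\<bar> < 1" and \<rho>: "\<bar>\<rho>\<^sub>1\<bar> < 1" "\<bar>\<rho>\<^sub>2\<bar> < 1" and yz: "y \<in> qS q" "z \<in> qS q"
  shows "(\<integral>\<^sup>+x. ennreal (fN q x * mehler q \<rho>\<^sub>1 y x * mehler q \<rho>\<^sub>2 z x) \<partial>lborel) =
    ennreal (mehler q (\<rho>\<^sub>1 * \<rho>\<^sub>2) y z)"
proof -
  obtain \<phi> \<psi> where y: "y = qx q \<phi>" and z: "z = qx q \<psi>"
    using qx_arccos[of q y] qx_arccos[of q z] q yz by (metis abs_less_iff)
  let ?f = "\<lambda>x. fN q x * mehler q \<rho>\<^sub>1 y x * mehler q \<rho>\<^sub>2 z x"
  \<comment> \<open>The half t >= 1/2 of the circle is used, because there x increases from the left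
    to the right end of \<open>qS q\<close>, as the substitution rule demands.\<close>
  let ?g = "\<lambda>t. qx q (2 * pi * t)"
  let ?g' = "\<lambda>t. - 4 * pi * sin (2 * pi * t) / sqrt (1 - q)"
  let ?w = "\<lambda>t. npoch q (cis (2 * (2 * pi * t))) / (wpoch q \<rho>\<^sub>1 \<phi> (2 * pi * t) * wpoch q \<rho>\<^sub>2 \<psi> (2 * pi * t))"
  let ?C = "rpoch q q * rpoch q (\<rho>\<^sub>1\<^sup>2) * rpoch q (\<rho>\<^sub>2\<^sup>2)"
  have \<rho>12: "\<bar>\<rho>\<^sub>1 * \<rho>\<^sub>2\<bar> < 1"
    using mult_strict_mono[of "\<bar>\<rho>\<^sub>1\<bar>" 1 "\<bar>\<rho>\<^sub>2\<bar>" 1] \<rho> by (simp add: abs_mult)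
  have w_pos: "wpoch q \<rho>\<^sub>1 \<phi> \<theta> > 0" "wpoch q \<rho>\<^sub>2 \<psi> \<theta> > 0" "wpoch q (\<rho>\<^sub>1 * \<rho>\<^sub>2) \<phi> \<psi> > 0" for \<theta>
    using wpoch_pos[OF q] \<rho> \<rho>12 by auto
  have C_nonneg: "?C \<ge> 0"
    using rpoch_pos[OF q] q \<rho> by (intro mult_nonneg_nonneg less_imp_le) (auto simp: abs_square_less_1)
  have ends: "?g (1/2) = - 2 / sqrt (1 - q)" "?g 1 = 2 / sqrt (1 - q)"
    by (simp_all add: qx_def)
  have qS: "{?g (1/2)..?g 1} = qS q"
    unfolding ends using q by (auto simp: qS_def)
  have w_cont: "continuous_on A ?w" for A
    using q w_pos[THEN less_imp_neq] by (intro continuous_intros) (auto simp: less_le)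
  have w_sym: "?w (1 - t) = ?w t" for t
  proof -
    have c: "cis (2 * pi - \<theta>) = cis (- \<theta>)" "cis (\<alpha> + 2 * pi) = cis \<alpha>" "cis (\<alpha> - 2 * pi) = cis \<alpha>" for \<theta> \<alpha>
      by (simp_all add: complex_eq_iff cos_diff sin_diff)
    have "wpoch q \<rho> \<alpha> (2 * pi * (1 - t)) = wpoch q \<rho> \<alpha> (- (2 * pi * t))" for \<rho> \<alpha>
      using c(2)[of "\<alpha> - 2 * pi * t"] c(3)[of "\<alpha> + 2 * pi * t"] unfolding wpoch_def
      by (simp add: algebra_simps)
    moreover have "cis (2 * (2 * pi * (1 - t))) = cis (- (2 * (2 * pi * t)))"
      using c(2)[of "2 * pi - 4 * pi * t"] c(1)[of "4 * pi * t"] by (simp add: algebra_simps)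
    ultimately show ?thesis
      using npoch_cis_minus[OF q, of 1 "2 * (2 * pi * t)"] wpoch_minus by simp
  qed
  have "(\<integral>\<^sup>+x. ennreal (?f x) \<partial>lborel) = (\<integral>\<^sup>+x. ennreal (?f x * indicator {?g (1/2)..?g 1} x) \<partial>lborel)"
    unfolding qS using q by (intro nn_integral_cong) (auto simp: fN_def split: split_indicator)
  also have "\<dots> = (\<integral>\<^sup>+t. ennreal (?f (?g t) * ?g' t * indicator {1/2..1} t) \<partial>lborel)"
  proof (rule nn_integral_substitution)
    have "(\<lambda>x. fN q x * (indicator (qS q) x * mehler q \<rho>\<^sub>1 y x) * (indicator (qS q) x * mehler q \<rho>\<^sub>2 z x)) \<in> borel_measurable borel"
      using q borel_measurable_times[OF borel_measurable_times[OF borel_measurable_fN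
          borel_measurable_mehler[OF q \<rho>(1) yz(1)]] borel_measurable_mehler[OF q \<rho>(2) yz(2)], of q]
      by simp
    also have "(\<lambda>x. fN q x * (indicator (qS q) x * mehler q \<rho>\<^sub>1 y x) * (indicator (qS q) x * mehler q \<rho>\<^sub>2 z x)) =
        (\<lambda>x. indicator (qS q) x *\<^sub>R ?f x)"
      by (auto simp: fun_eq_iff split: split_indicator)
    finally show "set_borel_measurable borel {?g (1/2)..?g 1} ?f"
      unfolding set_borel_measurable_def qS .
    show "(?g has_real_derivative ?g' t) (at t)" for t
    proof -
      define c where "c = 2 / sqrt (1 - q)"
      have "((\<lambda>t. c * cos (2 * pi * t)) has_real_derivative c * (- sin (2 * pi * t) * (2 * pi))) (at t)"
        by (auto intro!: derivative_eq_intros)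
      then show ?thesis
        by (simp add: qx_def c_def mult_ac)
    qed
    show "continuous_on {1/2..1} ?g'"
      using q by (intro continuous_intros) auto
    show "?g' t \<ge> 0" if "t \<in> {1/2..1}" for t
    proof -
      have "sin (2 * pi - 2 * pi * t) \<ge> 0"
        using that by (intro sin_ge_zero) (auto simp: algebra_simps)
      then have "sin (2 * pi * t) \<le> 0"
        by (simp add: sin_diff)
      then show ?thesis
        using q by (intro divide_nonneg_nonneg) (auto simp: mult_nonneg_nonpos)
    qed
  qed simp
  also have "\<dots> = (\<integral>\<^sup>+t. ennreal (indicator {1/2..1} t * (?C * ?w t)) \<partial>lborel)"
  proof (intro nn_integral_cong arg_cong[where f = ennreal])
    fix t :: real
    show "?f (?g t) * ?g' t * indicator {1/2..1} t = indicator {1/2..1} t * (?C * ?w t)"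
    proof (cases "t \<in> {1/2..1}")
      case True
      have "sin (2 * pi - 2 * pi * t) \<ge> 0"
        using True by (intro sin_ge_zero) (auto simp: algebra_simps)
      then have s: "\<bar>sin (2 * pi * t)\<bar> = - sin (2 * pi * t)"
        by (simp add: sin_diff)
      \<comment> \<open>The Jacobian cancels the denominator of \<open>fN\<close>. At the end
        points, where \<open>fN\<close> is 0 by division by zero, the right-hand side is 0 too,
        since the symbol has a zero at 1.\<close>
      have "fN q (?g t) * ?g' t = rpoch q q * npoch q (cis (2 * (2 * pi * t)))"
      proof (cases "sin (2 * pi * t) = 0")
        case True
        then have "cis (2 * (2 * pi * t)) = 1"
          using sin_double[of "2 * pi * t"] cos_double_sin[of "2 * pi * t"] by (simp add: complex_eq_iff)
        moreover have "npoch q 1 = 0"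
          using qpoch_rec[of "of_real q" 1] q by (simp add: npoch_def)
        ultimately show ?thesis using True by simp
      next
        case False
        then show ?thesis
          unfolding fN_qx[OF q] s using q by (simp add: field_simps)
      qed
      moreover have "?f (?g t) * ?g' t = fN q (?g t) * ?g' t * (mehler q \<rho>\<^sub>1 y (?g t) * mehler q \<rho>\<^sub>2 z (?g t))"
        by (simp only: mult_ac)
      ultimately have "?f (?g t) * ?g' t = rpoch q q * npoch q (cis (2 * (2 * pi * t))) * (mehler q \<rho>\<^sub>1 y (?g t) * mehler q \<rho>\<^sub>2 z (?g t))"
        by (simp only: )
      also have "\<dots> = ?C * ?w t"
        unfolding y z mehler_qx[OF q \<rho>(1)] mehler_qx[OF q \<rho>(2)] by simp
      finally show ?thesis using True by simp
    qed simp
  qed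
  also have "\<dots> = ennreal (?C * integral {1/2..1} ?w)"
  proof (rule nn_integral_has_integral_lebesgue)
    show "0 \<le> ?C * ?w t" for t
      using C_nonneg w_pos by (intro mult_nonneg_nonneg[OF C_nonneg] divide_nonneg_nonneg) (auto simp: npoch_def less_imp_le)
    show "((\<lambda>t. ?C * ?w t) has_integral ?C * integral {1/2..1} ?w) {1/2..1}"
      by (intro has_integral_mult_right integrable_integral integrable_continuous_real w_cont)
  qed
  \<comment> \<open>The half circle carries half of the full mean; this cancels the 2 in
    \<open>integral_npoch_wpoch\<close>.\<close>
  also have "?C * integral {1/2..1} ?w = ?C * integral {0..1} ?w / 2"
    using integral_double[OF w_cont w_sym] by simp
  also have "\<dots> = mehler q (\<rho>\<^sub>1 * \<rho>\<^sub>2) y z"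
    unfolding y z mehler_qx[OF q \<rho>12] using integral_npoch_wpoch[OF q \<rho>, of \<phi> \<psi>] w_pos(3)
    by (simp add: field_simps)
  finally show ?thesis .
qed

section \<open>The transition densities\<close>

text \<open>Correlation 0 means independence. Through it the stationarity of \<open>fN\<close>
  becomes a case of Chapman-Kolmogorov.\<close>

lemma fCN_0: "fCN q 0 y x = fN q x"
  by (simp add: fCN_def fN_def)

lemma fCN_nonneg:
  assumes "- 1 < q" "q \<le> 1" "\<bar>\<rho>\<bar> < 1" "y \<in> qS q"
  shows "fCN q \<rho> y x \<ge> 0"
proof (cases "q = 1")
  case True
  then show ?thesis using assms by (simp add: fCN_1)
next
  case False
  then have q: "\<bar>q\<bar> < 1" using assms by auto
  show ?thesis
  proof (cases "x \<in> qS q")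
    case True
    then show ?thesis
      using fCN_eq_mehler[OF False] fN_nonneg[of q x] mehler_nonneg[OF q assms(3) True assms(4)] assms by simp
  qed (use False in \<open>simp add: fCN_eq_mehler fN_def\<close>)
qed

lemma borel_measurable_fCN:
  assumes "- 1 < q" "q \<le> 1" "\<bar>\<rho>\<bar> < 1" "y \<in> qS q"
  shows "fCN q \<rho> y \<in> borel_measurable borel"
proof (cases "q = 1")
  case True
  then show ?thesis using assms by (simp add: fCN_1)
next
  case False
  then have q: "\<bar>q\<bar> < 1" using assms by auto
  have "fCN q \<rho> y = (\<lambda>x. fN q x * (indicator (qS q) x * mehler q \<rho> y x))"
    using False by (auto simp: fun_eq_iff fCN_eq_mehler fN_def split: split_indicator)
  then show ?thesis
    using borel_measurable_fN[OF assms(1,2)] borel_measurable_mehler[OF q assms(3,4)] by simp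
qed

text \<open>For |q| < 1 the symmetry of the kernel reduces measurability in the starting point to
  measurability in the end point.\<close>

lemma borel_measurable_fCN_left:
  assumes "- 1 < q" "q \<le> 1" "\<bar>\<rho>\<bar> < 1" "x \<in> qS q"
  shows "(\<lambda>y. fCN q \<rho> y x * indicator (qS q) y) \<in> borel_measurable borel"
proof (cases "q = 1")
  case True
  have "(\<lambda>y. normal_density (\<rho> * y) (sqrt (1 - \<rho>\<^sup>2)) x * indicator (qS q) y) \<in> borel_measurable borel"
    unfolding normal_density_def by measurable
  then show ?thesis using assms True by (simp add: fCN_1)
next
  case False
  then have q: "\<bar>q\<bar> < 1" using assms by auto
  have "(\<lambda>y. fCN q \<rho> y x * indicator (qS q) y) = (\<lambda>y. fN q x * (indicator (qS q) y * mehler q \<rho> x y))"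
    using False by (auto simp: fun_eq_iff fCN_eq_mehler mehler_commute)
  then show ?thesis
    using borel_measurable_mehler[OF q assms(3,4)] by simp
qed

text \<open>Each transition multiplies by its correlation and adds independent Gaussian noise, so
  the variances combine to (1 - rho_2^2) + rho_2^2 (1 - rho_1^2) = 1 - (rho_1 rho_2)^2.\<close>

lemma normal_density_chapman_kolmogorov:
  assumes \<rho>: "\<bar>\<rho>\<^sub>1\<bar> < 1" "\<bar>\<rho>\<^sub>2\<bar> < 1"
  shows "(\<integral>\<^sup>+v. ennreal (normal_density (\<rho>\<^sub>1 * u) (sqrt (1 - \<rho>\<^sub>1\<^sup>2)) v * normal_density (\<rho>\<^sub>2 * v) (sqrt (1 - \<rho>\<^sub>2\<^sup>2)) w) \<partial>lborel) =
    ennreal (normal_density (\<rho>\<^sub>1 * \<rho>\<^sub>2 * u) (sqrt (1 - (\<rho>\<^sub>1 * \<rho>\<^sub>2)\<^sup>2)) w)"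
proof -
  define s\<^sub>1 where "s\<^sub>1 = sqrt (1 - \<rho>\<^sub>1\<^sup>2)"
  define s\<^sub>2 where "s\<^sub>2 = sqrt (1 - \<rho>\<^sub>2\<^sup>2)"
  have sq: "\<rho>\<^sub>1\<^sup>2 < 1" "\<rho>\<^sub>2\<^sup>2 < 1"
    using \<rho> by (simp_all add: abs_square_less_1)
  then have s: "s\<^sub>1 > 0" "s\<^sub>2 > 0" "s\<^sub>1\<^sup>2 = 1 - \<rho>\<^sub>1\<^sup>2" "s\<^sub>2\<^sup>2 = 1 - \<rho>\<^sub>2\<^sup>2"
    by (simp_all add: s\<^sub>1_def s\<^sub>2_def)
  show ?thesis
  proof (cases "\<rho>\<^sub>2 = 0")
    case True
    have "(\<integral>\<^sup>+v. ennreal (normal_density (\<rho>\<^sub>1 * u) s\<^sub>1 v * normal_density 0 1 w) \<partial>lborel) =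
        ennreal (normal_density 0 1 w) * (\<integral>\<^sup>+v. ennreal (normal_density (\<rho>\<^sub>1 * u) s\<^sub>1 v) \<partial>lborel)"
      by (subst nn_integral_cmult[symmetric]) (auto simp: ennreal_mult' mult.commute)
    also have "(\<integral>\<^sup>+v. ennreal (normal_density (\<rho>\<^sub>1 * u) s\<^sub>1 v) \<partial>lborel) = 1"
      using prob_space.emeasure_space_1[OF prob_space_normal_density[OF s(1), of "\<rho>\<^sub>1 * u"]]
      by (simp add: emeasure_density)
    finally show ?thesis
      using True by (simp add: s\<^sub>1_def)
  next
    case False
    \<comment> \<open>With v = rho_1 u + t / rho_2 the variable t is the fluctuation of rho_2 v, and
      the integral becomes a convolution of two centred Gaussians at w - rho_1 rho_2 u. The division
      is the reason for the case split.\<close>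
    have "(\<integral>\<^sup>+v. ennreal (normal_density (\<rho>\<^sub>1 * u) s\<^sub>1 v * normal_density (\<rho>\<^sub>2 * v) s\<^sub>2 w) \<partial>lborel) =
      ennreal \<bar>1 / \<rho>\<^sub>2\<bar> * (\<integral>\<^sup>+t. ennreal (normal_density (\<rho>\<^sub>1 * u) s\<^sub>1 (\<rho>\<^sub>1 * u + 1 / \<rho>\<^sub>2 * t) * normal_density (\<rho>\<^sub>2 * (\<rho>\<^sub>1 * u + 1 / \<rho>\<^sub>2 * t)) s\<^sub>2 w) \<partial>lborel)"
      by (rule nn_integral_real_affine) (use False in \<open>auto simp: normal_density_def\<close>)
    also have "\<dots> = (\<integral>\<^sup>+t. ennreal (\<bar>1 / \<rho>\<^sub>2\<bar> * (normal_density (\<rho>\<^sub>1 * u) s\<^sub>1 (\<rho>\<^sub>1 * u + 1 / \<rho>\<^sub>2 * t) * normal_density (\<rho>\<^sub>2 * (\<rho>\<^sub>1 * u + 1 / \<rho>\<^sub>2 * t)) s\<^sub>2 w)) \<partial>lborel)"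
      unfolding ennreal_mult'[OF abs_ge_zero]
      by (rule nn_integral_cmult[symmetric]) (simp add: normal_density_def)
    also have "\<dots> = (\<integral>\<^sup>+t. ennreal (normal_density 0 s\<^sub>2 (w - \<rho>\<^sub>1 * \<rho>\<^sub>2 * u - t) * normal_density 0 (\<bar>\<rho>\<^sub>2\<bar> * s\<^sub>1) t) \<partial>lborel)"
    proof (intro nn_integral_cong arg_cong[where f = ennreal])
      fix t :: real
      have "\<bar>1 / \<rho>\<^sub>2\<bar> * normal_density (\<rho>\<^sub>1 * u) s\<^sub>1 (\<rho>\<^sub>1 * u + 1 / \<rho>\<^sub>2 * t) = normal_density 0 (\<bar>\<rho>\<^sub>2\<bar> * s\<^sub>1) t"
        using False s(1) unfolding normal_density_def
        by (simp add: power_mult_distrib power_divide real_sqrt_mult field_simps)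
      moreover have "normal_density (\<rho>\<^sub>2 * (\<rho>\<^sub>1 * u + 1 / \<rho>\<^sub>2 * t)) s\<^sub>2 w = normal_density 0 s\<^sub>2 (w - \<rho>\<^sub>1 * \<rho>\<^sub>2 * u - t)"
        using False unfolding normal_density_def by (simp add: algebra_simps)
      ultimately show "\<bar>1 / \<rho>\<^sub>2\<bar> * (normal_density (\<rho>\<^sub>1 * u) s\<^sub>1 (\<rho>\<^sub>1 * u + 1 / \<rho>\<^sub>2 * t) * normal_density (\<rho>\<^sub>2 * (\<rho>\<^sub>1 * u + 1 / \<rho>\<^sub>2 * t)) s\<^sub>2 w) =
         normal_density 0 s\<^sub>2 (w - \<rho>\<^sub>1 * \<rho>\<^sub>2 * u - t) * normal_density 0 (\<bar>\<rho>\<^sub>2\<bar> * s\<^sub>1) t"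
        by (metis mult.assoc mult.commute)
    qed
    also have "\<dots> = ennreal (normal_density 0 (sqrt (s\<^sub>2\<^sup>2 + (\<bar>\<rho>\<^sub>2\<bar> * s\<^sub>1)\<^sup>2)) (w - \<rho>\<^sub>1 * \<rho>\<^sub>2 * u))"
      using fun_cong[OF conv_normal_density_zero_mean[of s\<^sub>2 "\<bar>\<rho>\<^sub>2\<bar> * s\<^sub>1"], of "w - \<rho>\<^sub>1 * \<rho>\<^sub>2 * u"] s False by simp
    also have "s\<^sub>2\<^sup>2 + (\<bar>\<rho>\<^sub>2\<bar> * s\<^sub>1)\<^sup>2 = 1 - (\<rho>\<^sub>1 * \<rho>\<^sub>2)\<^sup>2"
      unfolding power_mult_distrib s power2_abs by algebra
    also have "normal_density 0 (sqrt (1 - (\<rho>\<^sub>1 * \<rho>\<^sub>2)\<^sup>2)) (w - \<rho>\<^sub>1 * \<rho>\<^sub>2 * u) = normal_density (\<rho>\<^sub>1 * \<rho>\<^sub>2 * u) (sqrt (1 - (\<rho>\<^sub>1 * \<rho>\<^sub>2)\<^sup>2)) w"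
      by (simp add: normal_density_def)
    finally show ?thesis
      unfolding s\<^sub>1_def s\<^sub>2_def .
  qed
qed

lemma abs_mult_less_1:
  fixes x y :: real
  assumes "\<bar>x\<bar> < 1" "\<bar>y\<bar> < 1"
  shows "\<bar>x * y\<bar> < 1"
  using mult_strict_mono[of "\<bar>x\<bar>" 1 "\<bar>y\<bar>" 1] assms by (simp add: abs_mult)

text \<open>For |q| < 1 the factor \<open>fN q w\<close> comes out of the integral; after exchanging
  the arguments of the second kernel, the rest is \<open>nn_integral_fN_mehler\<close>.\<close>

lemma nn_integral_fCN_fCN:
  assumes "- 1 < q" "q \<le> 1" and \<rho>: "\<bar>\<rho>\<^sub>1\<bar> < 1" "\<bar>\<rho>\<^sub>2\<bar> < 1" and uw: "u \<in> qS q" "w \<in> qS q"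
  shows "(\<integral>\<^sup>+v. ennreal (fCN q \<rho>\<^sub>1 u v * fCN q \<rho>\<^sub>2 v w * indicator (qS q) v) \<partial>lborel) = ennreal (fCN q (\<rho>\<^sub>1 * \<rho>\<^sub>2) u w)"
proof (cases "q = 1")
  case True
  then show ?thesis
    using normal_density_chapman_kolmogorov[OF \<rho>, of u w] \<rho> abs_mult_less_1[OF \<rho>] by (simp add: fCN_1 qS_def)
next
  case False
  then have q: "\<bar>q\<bar> < 1" using assms by auto
  have "(\<integral>\<^sup>+v. ennreal (fCN q \<rho>\<^sub>1 u v * fCN q \<rho>\<^sub>2 v w * indicator (qS q) v) \<partial>lborel) =
      (\<integral>\<^sup>+v. ennreal (fN q w) * ennreal (fN q v * mehler q \<rho>\<^sub>1 u v * mehler q \<rho>\<^sub>2 w v) \<partial>lborel)"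
    using False fN_nonneg[OF assms(1,2)]
    by (intro nn_integral_cong)
      (auto simp: fCN_eq_mehler fN_def mehler_commute mult_ac ennreal_mult'[symmetric] split: split_indicator)
  also have "\<dots> = ennreal (fN q w) * (\<integral>\<^sup>+v. ennreal (fN q v * mehler q \<rho>\<^sub>1 u v * mehler q \<rho>\<^sub>2 w v) \<partial>lborel)"
  proof (rule nn_integral_cmult)
    have "(\<lambda>v. fCN q \<rho>\<^sub>1 u v * (indicator (qS q) v * mehler q \<rho>\<^sub>2 w v)) \<in> borel_measurable lborel"
      using borel_measurable_fCN[OF assms(1,2) \<rho>(1) uw(1)] borel_measurable_mehler[OF q \<rho>(2) uw(2)] by simp
    also have "(\<lambda>v. fCN q \<rho>\<^sub>1 u v * (indicator (qS q) v * mehler q \<rho>\<^sub>2 w v)) = (\<lambda>v. fN q v * mehler q \<rho>\<^sub>1 u v * mehler q \<rho>\<^sub>2 w v)"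
      using False by (auto simp: fun_eq_iff fCN_eq_mehler fN_def split: split_indicator)
    finally show "(\<lambda>v. ennreal (fN q v * mehler q \<rho>\<^sub>1 u v * mehler q \<rho>\<^sub>2 w v)) \<in> borel_measurable lborel"
      by simp
  qed
  also have "\<dots> = ennreal (fN q w) * ennreal (mehler q (\<rho>\<^sub>1 * \<rho>\<^sub>2) u w)"
    by (simp add: nn_integral_fN_mehler[OF q \<rho> uw])
  also have "\<dots> = ennreal (fCN q (\<rho>\<^sub>1 * \<rho>\<^sub>2) u w)"
    using False fN_nonneg[OF assms(1,2)] by (simp add: fCN_eq_mehler ennreal_mult')
  finally show ?thesis .
qed

text \<open>Chapman-Kolmogorov with first correlation 0, where the starting point drops out and w
  can stand in for it.\<close>

lemma nn_integral_fN_fCN: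
  assumes "- 1 < q" "q \<le> 1" "\<bar>\<rho>\<bar> < 1" "w \<in> qS q"
  shows "(\<integral>\<^sup>+v. ennreal (fN q v * fCN q \<rho> v w * indicator (qS q) v) \<partial>lborel) = ennreal (fN q w)"
  using nn_integral_fCN_fCN[OF assms(1,2), of 0 \<rho> w w] assms by (simp add: fCN_0)

text \<open>For |q| < 1 this is the composition of kernels with second correlation 0. The version
  for \<open>mehler\<close> is used because the one for \<open>fCN\<close> would leave a factor
  \<open>fN q w\<close> to divide out.\<close>

lemma nn_integral_fCN:
  assumes "- 1 < q" "q \<le> 1" "\<bar>\<rho>\<bar> < 1" "u \<in> qS q"
  shows "(\<integral>\<^sup>+v. ennreal (fCN q \<rho> u v * indicator (qS q) v) \<partial>lborel) = 1"
proof (cases "q = 1")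
  case True
  have "sqrt (1 - \<rho>\<^sup>2) > 0"
    using assms(3) by (simp add: abs_square_less_1)
  from prob_space.emeasure_space_1[OF prob_space_normal_density[OF this, of "\<rho> * u"]] show ?thesis
    using True assms by (simp add: emeasure_density fCN_1 qS_def)
next
  case False
  then have q: "\<bar>q\<bar> < 1" using assms by auto
  have m0: "mehler q 0 y x = 1" for y x
    by (simp add: mehler_def)
  have "(\<integral>\<^sup>+v. ennreal (fCN q \<rho> u v * indicator (qS q) v) \<partial>lborel) = (\<integral>\<^sup>+v. ennreal (fN q v * mehler q \<rho> u v * mehler q 0 u v) \<partial>lborel)"
    using False by (intro nn_integral_cong) (auto simp: m0 fCN_eq_mehler fN_def split: split_indicator)
  also have "\<dots> = 1"
    using nn_integral_fN_mehler[OF q assms(3), of 0 u u] assms by (simp add: m0)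
  finally show ?thesis .
qed

section \<open>Marginals\<close>

definition chain_density :: "real \<Rightarrow> (nat \<Rightarrow> real) \<Rightarrow> nat \<Rightarrow> (nat \<Rightarrow> real) \<Rightarrow> real" where
  "chain_density q \<rho> d u = fN q (u 1) * (\<Prod>i\<in>{1..<d}. fCN q (\<rho> i) (u i) (u (Suc i)))"

lemma multi_qNormal_density_chain:
  "multi_qNormal_density q d m \<sigma> \<rho> x =
    (if \<forall>i\<in>{1..d}. (x i - m i) / \<sigma> i \<in> qS q
     then chain_density q \<rho> d (\<lambda>i. (x i - m i) / \<sigma> i) / (\<Prod>i\<in>{1..d}. \<sigma> i) else 0)"
  by (simp add: multi_qNormal_density_def chain_density_def)

text \<open>Deleting the coordinate \<open>Suc k\<close>: the old indices of the remaining coordinates, the inverse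
  renumbering, and the remaining correlations, where the two adjacent to the deleted one multiply.\<close>

definition skip :: "nat \<Rightarrow> nat \<Rightarrow> nat" where
  "skip k j = (if j \<le> k then j else Suc j)"

definition unskip :: "nat \<Rightarrow> nat \<Rightarrow> nat" where
  "unskip k i = (if i \<le> k then i else i - 1)"

definition merge_corr :: "nat \<Rightarrow> (nat \<Rightarrow> real) \<Rightarrow> nat \<Rightarrow> real" where
  "merge_corr k \<rho> j = (if j < k then \<rho> j else if j = k then \<rho> k * \<rho> (Suc k) else \<rho> (Suc j))"

lemma chain_density_cong:
  assumes "1 \<le> d" "\<And>i. i \<in> {1..d} \<Longrightarrow> u i = v i"
  shows "chain_density q \<rho> d u = chain_density q \<rho> d v"
  using assms unfolding chain_density_def by (intro arg_cong2[where f = "(*)"] prod.cong) auto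

lemma nn_integral_cmult_ennreal:
  assumes "0 \<le> a" "f \<in> borel_measurable M"
  shows "(\<integral>\<^sup>+x. ennreal (a * f x) \<partial>M) = ennreal a * (\<integral>\<^sup>+x. ennreal (f x) \<partial>M)"
  using assms by (simp add: ennreal_mult' nn_integral_cmult)

text \<open>Only the factors next to the deleted coordinate depend on v. They integrate by
  stationarity at the first coordinate (k = 0), by total mass at the last (k = d) and by
  Chapman-Kolmogorov in between. In the two outer cases \<open>merge_corr\<close> forms no product
  on {1..<d}.\<close>

lemma nn_integral_chain_density:
  assumes q: "- 1 < q" "q \<le> 1" and d: "1 \<le> d" and k: "k \<le> d"
    and \<rho>: "\<And>i. i \<in> {1..<Suc d} \<Longrightarrow> \<bar>\<rho> i\<bar> < 1"
    and u: "\<And>i. i \<in> {1..Suc d} - {Suc k} \<Longrightarrow> u i \<in> qS q"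
  shows "(\<integral>\<^sup>+v. ennreal (chain_density q \<rho> (Suc d) (u(Suc k := v)) * indicator (qS q) v) \<partial>lborel) =
    ennreal (chain_density q (merge_corr k \<rho>) d (\<lambda>j. u (skip k j)))"
proof -
  let ?t = "\<lambda>i. fCN q (\<rho> i) (u i) (u (Suc i))"
  have t: "0 \<le> ?t i" if "i \<in> {1..<Suc d} - {k, Suc k}" for i
    using that q \<rho> u by (intro fCN_nonneg) auto
  consider "k = 0" | "k = d" "k \<noteq> 0" | "1 \<le> k" "k < d"
    using k by linarith
  then show ?thesis
  proof cases
    case 1
    define A where "A = (\<Prod>i\<in>{2..<Suc d}. ?t i)"
    have A: "0 \<le> A"
      unfolding A_def using t 1 by (intro prod_nonneg) auto
    have "chain_density q \<rho> (Suc d) (u(Suc k := v)) = A * (fN q v * fCN q (\<rho> 1) v (u 2))" for v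
    proof -
      have "{1..<Suc d} = insert 1 {2..<Suc d}"
        using d by auto
      then show ?thesis
        unfolding chain_density_def A_def using 1 by (simp add: numeral_2_eq_2 mult_ac)
    qed
    then have "(\<integral>\<^sup>+v. ennreal (chain_density q \<rho> (Suc d) (u(Suc k := v)) * indicator (qS q) v) \<partial>lborel) =
        ennreal A * (\<integral>\<^sup>+v. ennreal (fN q v * fCN q (\<rho> 1) v (u 2) * indicator (qS q) v) \<partial>lborel)"
      using borel_measurable_times[OF borel_measurable_fN[OF q] borel_measurable_fCN_left[OF q, of "\<rho> 1" "u 2"]] \<rho> u d 1
      by (subst nn_integral_cmult_ennreal[symmetric]) (auto simp: A mult.assoc)
    also have "\<dots> = ennreal A * ennreal (fN q (u 2))"
      using \<rho> u d 1 by (subst nn_integral_fN_fCN[OF q]) auto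
    also have "\<dots> = ennreal (A * fN q (u 2))"
      using A by (simp add: ennreal_mult')
    also have "A * fN q (u 2) = chain_density q (merge_corr k \<rho>) d (\<lambda>j. u (skip k j))"
    proof -
      have "A = (\<Prod>i\<in>{1..<d}. ?t (Suc i))"
        unfolding A_def numeral_2_eq_2 One_nat_def by (rule prod.shift_bounds_Suc_ivl)
      also have "\<dots> = (\<Prod>i\<in>{1..<d}. fCN q (merge_corr k \<rho> i) (u (skip k i)) (u (skip k (Suc i))))"
        using 1 by (intro prod.cong) (auto simp: merge_corr_def skip_def)
      finally show ?thesis
        using 1 by (simp add: chain_density_def skip_def numeral_2_eq_2)
    qed
    finally show ?thesis .
  next
    case 2
    define A where "A = fN q (u 1) * (\<Prod>i\<in>{1..<d}. ?t i)"
    have A: "0 \<le> A"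
      unfolding A_def using t 2 by (intro mult_nonneg_nonneg prod_nonneg fN_nonneg q) auto
    have "chain_density q \<rho> (Suc d) (u(Suc k := v)) = A * fCN q (\<rho> d) (u d) v" for v
    proof -
      have "(\<Prod>i\<in>{1..<d}. fCN q (\<rho> i) ((u(Suc k := v)) i) ((u(Suc k := v)) (Suc i))) = (\<Prod>i\<in>{1..<d}. ?t i)"
        using 2 by (intro prod.cong) auto
      then show ?thesis
        unfolding chain_density_def A_def using 2 d by (simp add: prod.atLeastLessThan_Suc)
    qed
    then have "(\<integral>\<^sup>+v. ennreal (chain_density q \<rho> (Suc d) (u(Suc k := v)) * indicator (qS q) v) \<partial>lborel) =
        ennreal A * (\<integral>\<^sup>+v. ennreal (fCN q (\<rho> d) (u d) v * indicator (qS q) v) \<partial>lborel)"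
      using borel_measurable_fCN[OF q, of "\<rho> d" "u d"] \<rho> u d 2
      by (subst nn_integral_cmult_ennreal[symmetric]) (auto simp: A mult.assoc)
    also have "\<dots> = ennreal A"
      using \<rho> u d 2 by (subst nn_integral_fCN[OF q]) auto
    also have "A = chain_density q (merge_corr k \<rho>) d (\<lambda>j. u (skip k j))"
      unfolding A_def chain_density_def using 2
      by (intro arg_cong2[where f = "(*)"] prod.cong) (auto simp: merge_corr_def skip_def)
    finally show ?thesis .
  next
    case 3
    define A where "A = fN q (u 1) * (\<Prod>i\<in>{1..<k}. ?t i) * (\<Prod>i\<in>{Suc (Suc k)..<Suc d}. ?t i)"
    have A: "0 \<le> A"
      unfolding A_def using t 3 by (intro mult_nonneg_nonneg prod_nonneg fN_nonneg q) auto
    have split: "{1..<Suc d} = {1..<k} \<union> {k} \<union> {Suc k} \<union> {Suc (Suc k)..<Suc d}"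
      using 3 by auto
    have split': "{1..<d} = {1..<k} \<union> {k} \<union> {Suc k..<d}"
      using 3 by auto
    have "chain_density q \<rho> (Suc d) (u(Suc k := v)) =
        A * (fCN q (\<rho> k) (u k) v * fCN q (\<rho> (Suc k)) v (u (Suc (Suc k))))" for v
    proof -
      let ?s = "\<lambda>i. fCN q (\<rho> i) ((u(Suc k := v)) i) ((u(Suc k := v)) (Suc i))"
      have "(\<Prod>i\<in>{1..<Suc d}. ?s i) = (\<Prod>i\<in>{1..<k}. ?s i) * ?s k * ?s (Suc k) * (\<Prod>i\<in>{Suc (Suc k)..<Suc d}. ?s i)"
        unfolding split by (subst prod.union_disjoint; force)+
      moreover have "(\<Prod>i\<in>{1..<k}. ?s i) = (\<Prod>i\<in>{1..<k}. ?t i)"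
        by (intro prod.cong) auto
      moreover have "(\<Prod>i\<in>{Suc (Suc k)..<Suc d}. ?s i) = (\<Prod>i\<in>{Suc (Suc k)..<Suc d}. ?t i)"
        by (intro prod.cong) auto
      ultimately show ?thesis
        unfolding chain_density_def A_def using 3 by (simp add: mult_ac)
    qed
    then have "(\<integral>\<^sup>+v. ennreal (chain_density q \<rho> (Suc d) (u(Suc k := v)) * indicator (qS q) v) \<partial>lborel) =
        ennreal A * (\<integral>\<^sup>+v. ennreal (fCN q (\<rho> k) (u k) v * fCN q (\<rho> (Suc k)) v (u (Suc (Suc k))) * indicator (qS q) v) \<partial>lborel)"
      using borel_measurable_times[OF borel_measurable_fCN[OF q, of "\<rho> k" "u k"]
          borel_measurable_fCN_left[OF q, of "\<rho> (Suc k)" "u (Suc (Suc k))"]] \<rho> u 3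
      by (subst nn_integral_cmult_ennreal[symmetric]) (auto simp: A mult.assoc)
    also have "\<dots> = ennreal A * ennreal (fCN q (\<rho> k * \<rho> (Suc k)) (u k) (u (Suc (Suc k))))"
      using \<rho> u 3 by (subst nn_integral_fCN_fCN[OF q]) auto
    also have "\<dots> = ennreal (A * fCN q (\<rho> k * \<rho> (Suc k)) (u k) (u (Suc (Suc k))))"
      using A by (simp add: ennreal_mult')
    also have "A * fCN q (\<rho> k * \<rho> (Suc k)) (u k) (u (Suc (Suc k))) = chain_density q (merge_corr k \<rho>) d (\<lambda>j. u (skip k j))"
    proof -
      let ?s = "\<lambda>i. fCN q (merge_corr k \<rho> i) (u (skip k i)) (u (skip k (Suc i)))"
      have "(\<Prod>i\<in>{1..<d}. ?s i) = (\<Prod>i\<in>{1..<k}. ?s i) * ?s k * (\<Prod>i\<in>{Suc k..<d}. ?s i)"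
        unfolding split' by (subst prod.union_disjoint; force)+
      moreover have "(\<Prod>i\<in>{1..<k}. ?s i) = (\<Prod>i\<in>{1..<k}. ?t i)"
        by (intro prod.cong) (auto simp: merge_corr_def skip_def)
      moreover have "(\<Prod>i\<in>{Suc k..<d}. ?s i) = (\<Prod>i\<in>{Suc k..<d}. ?t (Suc i))"
        by (intro prod.cong) (auto simp: merge_corr_def skip_def)
      moreover have "(\<Prod>i\<in>{Suc k..<d}. ?t (Suc i)) = (\<Prod>i\<in>{Suc (Suc k)..<Suc d}. ?t i)"
        by (rule prod.shift_bounds_Suc_ivl[symmetric])
      ultimately show ?thesis
        unfolding chain_density_def A_def using 3 by (simp add: merge_corr_def skip_def mult_ac)
    qed
    finally show ?thesis .
  qed
qed

section \<open>Lebesgue measure under renumbering and rescaling of coordinates\<close>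

interpretation lborel_product: product_sigma_finite "\<lambda>_::nat. lborel :: real measure"
  by standard

lemma skip_unskip: "i \<noteq> Suc k \<Longrightarrow> skip k (unskip k i) = i"
  by (auto simp: skip_def unskip_def)

lemma unskip_skip [simp]: "unskip k (skip k j) = j"
  by (auto simp: skip_def unskip_def)

lemma bij_betw_skip:
  assumes "k \<le> d"
  shows "bij_betw (skip k) {1..d} ({1..Suc d} - {Suc k})"
  by (rule bij_betw_byWitness[where f' = "unskip k"])
    (use assms in \<open>auto simp: skip_unskip\<close>, auto simp: skip_def unskip_def split: if_splits)

lemma measurable_reindex:
  assumes "t \<in> J \<rightarrow> I"
  shows "(\<lambda>x. \<lambda>j\<in>J. x (t j)) \<in> (\<Pi>\<^sub>M i\<in>I. lborel :: real measure) \<rightarrow>\<^sub>M (\<Pi>\<^sub>M j\<in>J. lborel)"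
  using assms by (intro measurable_restrict measurable_component_singleton) auto

text \<open>A box is pulled back to the box with renumbered sides, which has the same volume, and
  boxes determine the product measure.\<close>

lemma distr_PiM_lborel_reindex:
  fixes t :: "nat \<Rightarrow> nat"
  assumes "finite J" "bij_betw t J I"
  shows "distr (\<Pi>\<^sub>M i\<in>I. lborel :: real measure) (\<Pi>\<^sub>M j\<in>J. lborel) (\<lambda>x. \<lambda>j\<in>J. x (t j)) = (\<Pi>\<^sub>M j\<in>J. lborel)"
proof (rule lborel_product.PiM_eqI)
  have tJ: "t \<in> J \<rightarrow> I" and I: "I = t ` J" and inj: "inj_on t J"
    using assms(2) by (auto simp: bij_betw_def)
  fix A :: "nat \<Rightarrow> real set"
  assume A: "\<And>j. j \<in> J \<Longrightarrow> A j \<in> sets lborel"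
  let ?B = "\<lambda>i. A (inv_into J t i)"
  have "(\<lambda>x. \<lambda>j\<in>J. x (t j)) -` (\<Pi>\<^sub>E j\<in>J. A j) \<inter> space (\<Pi>\<^sub>M i\<in>I. lborel) = (\<Pi>\<^sub>E i\<in>I. ?B i)"
    unfolding I using inj by (auto simp: space_PiM PiE_iff)
  moreover have "(\<Pi>\<^sub>E j\<in>J. A j) \<in> sets (\<Pi>\<^sub>M j\<in>J. lborel)"
    using A assms(1) by (intro sets_PiM_I_finite) auto
  ultimately have "emeasure (distr (\<Pi>\<^sub>M i\<in>I. lborel) (\<Pi>\<^sub>M j\<in>J. lborel) (\<lambda>x. \<lambda>j\<in>J. x (t j))) (\<Pi>\<^sub>E j\<in>J. A j) =
      emeasure (\<Pi>\<^sub>M i\<in>I. lborel) (\<Pi>\<^sub>E i\<in>I. ?B i)"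
    using measurable_reindex[OF tJ] by (simp add: emeasure_distr)
  also have "\<dots> = (\<Prod>i\<in>I. emeasure lborel (?B i))"
    using A assms(1) inj unfolding I by (intro lborel_product.emeasure_PiM) auto
  also have "\<dots> = (\<Prod>j\<in>J. emeasure lborel (A j))"
    unfolding I using inj by (simp add: prod.reindex)
  finally show "emeasure (distr (\<Pi>\<^sub>M i\<in>I. lborel) (\<Pi>\<^sub>M j\<in>J. lborel) (\<lambda>x. \<lambda>j\<in>J. x (t j))) (\<Pi>\<^sub>E j\<in>J. A j) =
      (\<Prod>j\<in>J. emeasure lborel (A j))" .
qed (use assms in auto)

lemma nn_integral_scaled:
  assumes "F \<in> borel_measurable borel" "0 < s"
  shows "(\<integral>\<^sup>+y. ennreal (F ((y - m) / s) / s) \<partial>lborel) = (\<integral>\<^sup>+v. ennreal (F v) \<partial>lborel)"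
proof -
  have "(\<integral>\<^sup>+v. ennreal (F v) \<partial>lborel) = ennreal \<bar>1 / s\<bar> * (\<integral>\<^sup>+y. ennreal (F (- m / s + 1 / s * y)) \<partial>lborel)"
    using assms by (intro nn_integral_real_affine) auto
  also have "\<dots> = (\<integral>\<^sup>+y. ennreal (1 / s * F (- m / s + 1 / s * y)) \<partial>lborel)"
    using assms by (subst nn_integral_cmult_ennreal) auto
  also have "\<dots> = (\<integral>\<^sup>+y. ennreal (F ((y - m) / s) / s) \<partial>lborel)"
    using assms(2) by (intro nn_integral_cong) (simp add: diff_divide_distrib)
  finally show ?thesis ..
qed

lemma borel_measurable_chain_density_upd:
  assumes q: "- 1 < q" "q \<le> 1" and d: "1 \<le> d" and k: "k \<le> d"
    and \<rho>: "\<And>i. i \<in> {1..<Suc d} \<Longrightarrow> \<bar>\<rho> i\<bar> < 1"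
    and u: "\<And>i. i \<in> {1..Suc d} - {Suc k} \<Longrightarrow> u i \<in> qS q"
  shows "(\<lambda>v. chain_density q \<rho> (Suc d) (u(Suc k := v)) * indicator (qS q) v) \<in> borel_measurable borel"
proof -
  have "(\<lambda>v. fCN q (\<rho> i) ((u(Suc k := v)) i) ((u(Suc k := v)) (Suc i)) * indicator (qS q) v) \<in> borel_measurable borel"
    if "i \<in> {1..<Suc d}" for i
  proof -
    consider "i = Suc k" | "i = k" | "i \<noteq> k" "i \<noteq> Suc k" by blast
    then show ?thesis
    proof cases
      case 1
      then show ?thesis
        using borel_measurable_fCN_left[OF q \<rho>[OF that], of "u (Suc i)"] u that by simp
    next
      case 2
      then show ?thesis
        using borel_measurable_fCN[OF q \<rho>[OF that], of "u i"] u that by simp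
    qed simp
  qed
  \<comment> \<open>The indicator goes into every factor, so that each is measurable on its own.
    Being idempotent, it multiplies out to a single indicator, because {1..<Suc d} is nonempty for d
    >= 1.\<close>
  then have "(\<lambda>v. (if k = 0 then fN q v else fN q (u 1)) *
      (\<Prod>i\<in>{1..<Suc d}. fCN q (\<rho> i) ((u(Suc k := v)) i) ((u(Suc k := v)) (Suc i)) * indicator (qS q) v)) \<in> borel_measurable borel"
    using borel_measurable_fN[OF q] by (intro borel_measurable_times[OF _ borel_measurable_prod]) auto
  also have "(\<lambda>v. (if k = 0 then fN q v else fN q (u 1)) *
      (\<Prod>i\<in>{1..<Suc d}. fCN q (\<rho> i) ((u(Suc k := v)) i) ((u(Suc k := v)) (Suc i)) * indicator (qS q) v)) =
      (\<lambda>v. chain_density q \<rho> (Suc d) (u(Suc k := v)) * indicator (qS q) v)"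
    using d by (auto simp: fun_eq_iff chain_density_def split: split_indicator)
  finally show ?thesis .
qed

text \<open>If a remaining standardised coordinate leaves \<open>qS q\<close>, both sides are 0.
  Otherwise the scale of the deleted coordinate is absorbed by an affine substitution and the other
  scales form the constant \<open>P\<close>.\<close>

lemma nn_integral_multi_qNormal_density:
  assumes q: "- 1 < q" "q \<le> 1" and d: "1 \<le> d" and k: "k \<le> d"
    and \<sigma>: "\<And>i. i \<in> {1..Suc d} \<Longrightarrow> 0 < \<sigma> i"
    and \<rho>: "\<And>i. i \<in> {1..<Suc d} \<Longrightarrow> \<bar>\<rho> i\<bar> < 1"
    and z: "\<And>j. j \<in> {1..d} \<Longrightarrow> z j = x (skip k j)"
  shows "(\<integral>\<^sup>+y. ennreal (multi_qNormal_density q (Suc d) m \<sigma> \<rho> (x(Suc k := y))) \<partial>lborel) =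
    ennreal (multi_qNormal_density q d (m \<circ> skip k) (\<sigma> \<circ> skip k) (merge_corr k \<rho>) z)"
proof -
  let ?n = "Suc k" and ?I = "{1..Suc d}"
  define u where "u i = (x i - m i) / \<sigma> i" for i
  have upd: "(\<lambda>i. ((x(?n := y)) i - m i) / \<sigma> i) = u(?n := (y - m ?n) / \<sigma> ?n)" for y
    by (auto simp: u_def fun_eq_iff)
  have n: "?n \<in> ?I"
    using k by auto
  have bij: "bij_betw (skip k) {1..d} (?I - {?n})"
    using k by (rule bij_betw_skip)
  then have img: "?I - {?n} = skip k ` {1..d}"
    by (simp add: bij_betw_def)
  have cond: "(\<forall>j\<in>{1..d}. (z j - (m \<circ> skip k) j) / (\<sigma> \<circ> skip k) j \<in> qS q) \<longleftrightarrow> (\<forall>i\<in>?I - {?n}. u i \<in> qS q)"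
    unfolding img by (simp add: z u_def)
  show ?thesis
  proof (cases "\<forall>i\<in>?I - {?n}. u i \<in> qS q")
    case False
    have "multi_qNormal_density q (Suc d) m \<sigma> \<rho> (x(?n := y)) = 0" for y
      using False unfolding multi_qNormal_density_chain upd[unfolded fun_eq_iff, rule_format] by auto
    moreover have "multi_qNormal_density q d (m \<circ> skip k) (\<sigma> \<circ> skip k) (merge_corr k \<rho>) z = 0"
      unfolding multi_qNormal_density_chain cond if_not_P[OF False] ..
    ultimately show ?thesis
      by simp
  next
    case True
    define P where "P = (\<Prod>i\<in>?I - {?n}. \<sigma> i)"
    have P: "P > 0"
      unfolding P_def using \<sigma> by (intro prod_pos) auto
    have prod: "(\<Prod>i\<in>?I. \<sigma> i) = P * \<sigma> ?n"
      unfolding P_def using n by (subst prod.remove[of _ ?n]) auto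
    have \<sigma>n: "\<sigma> ?n > 0"
      using \<sigma> n by auto
    let ?F = "\<lambda>v. chain_density q \<rho> (Suc d) (u(?n := v)) * indicator (qS q) v"
    have "multi_qNormal_density q (Suc d) m \<sigma> \<rho> (x(?n := y)) = 1 / P * (?F ((y - m ?n) / \<sigma> ?n) / \<sigma> ?n)" for y
    proof -
      have cond_y: "(\<forall>i\<in>?I. ((x(?n := y)) i - m i) / \<sigma> i \<in> qS q) \<longleftrightarrow> (y - m ?n) / \<sigma> ?n \<in> qS q"
        unfolding upd[unfolded fun_eq_iff, rule_format] using True n by auto
      show ?thesis
        unfolding multi_qNormal_density_chain cond_y upd prod by (simp split: split_indicator)
    qed
    moreover have F: "?F \<in> borel_measurable borel"
      using True by (intro borel_measurable_chain_density_upd q d k \<rho>) auto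
    ultimately have "(\<integral>\<^sup>+y. ennreal (multi_qNormal_density q (Suc d) m \<sigma> \<rho> (x(?n := y))) \<partial>lborel) =
        ennreal (1 / P) * (\<integral>\<^sup>+y. ennreal (?F ((y - m ?n) / \<sigma> ?n) / \<sigma> ?n) \<partial>lborel)"
      using P measurable_compose[OF _ F, of "\<lambda>y. (y - m ?n) / \<sigma> ?n" lborel]
      by (subst nn_integral_cmult_ennreal[symmetric]) auto
    also have "\<dots> = ennreal (1 / P) * ennreal (chain_density q (merge_corr k \<rho>) d (\<lambda>j. u (skip k j)))"
      using True by (subst nn_integral_scaled[OF F \<sigma>n], subst nn_integral_chain_density[OF q d k \<rho>]) auto
    also have "\<dots> = ennreal (chain_density q (merge_corr k \<rho>) d (\<lambda>j. u (skip k j)) / P)"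
      using P by (simp add: ennreal_mult'[symmetric])
    also have "chain_density q (merge_corr k \<rho>) d (\<lambda>j. u (skip k j)) / P =
        multi_qNormal_density q d (m \<circ> skip k) (\<sigma> \<circ> skip k) (merge_corr k \<rho>) z"
    proof -
      have "P = (\<Prod>j\<in>{1..d}. (\<sigma> \<circ> skip k) j)"
        unfolding P_def using prod.reindex_bij_betw[OF bij, of \<sigma>] by simp
      moreover have "chain_density q (merge_corr k \<rho>) d (\<lambda>j. u (skip k j)) =
          chain_density q (merge_corr k \<rho>) d (\<lambda>j. (z j - (m \<circ> skip k) j) / (\<sigma> \<circ> skip k) j)"
        using z by (intro chain_density_cong d) (auto simp: u_def)
      ultimately show ?thesis
        using True cond by (simp add: multi_qNormal_density_chain)
    qed
    finally show ?thesis .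
  qed
qed

text \<open>Integrating first over the deleted coordinate and then renumbering the others turns the
  joint law into the marginal one.\<close>

lemma distributed_delete_coordinate:
  fixes X :: "nat \<Rightarrow> 'a \<Rightarrow> real"
  assumes q: "- 1 < q" "q \<le> 1" and d: "1 \<le> d" and k: "k \<le> d"
    and \<sigma>: "\<And>i. i \<in> {1..Suc d} \<Longrightarrow> 0 < \<sigma> i"
    and \<rho>: "\<And>i. i \<in> {1..<Suc d} \<Longrightarrow> \<bar>\<rho> i\<bar> < 1"
    and X: "distributed M (\<Pi>\<^sub>M i\<in>{1..Suc d}. lborel) (\<lambda>\<omega>. \<lambda>i\<in>{1..Suc d}. X i \<omega>)
      (\<lambda>x. ennreal (multi_qNormal_density q (Suc d) m \<sigma> \<rho> x))"
  shows "distributed M (\<Pi>\<^sub>M j\<in>{1..d}. lborel) (\<lambda>\<omega>. \<lambda>j\<in>{1..d}. X (skip k j) \<omega>)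
    (\<lambda>z. ennreal (multi_qNormal_density q d (m \<circ> skip k) (\<sigma> \<circ> skip k) (merge_corr k \<rho>) z))"
proof -
  let ?n = "Suc k" and ?I = "{1..Suc d}" and ?D = "{1..d}"
  define J where "J = ?I - {?n}"
  let ?L = "\<lambda>I. \<Pi>\<^sub>M i\<in>I. lborel :: real measure"
  let ?Y = "\<lambda>\<omega>. \<lambda>i\<in>?I. X i \<omega>"
  let ?T = "\<lambda>x. \<lambda>j\<in>?D. x (skip k j)"
  let ?R = "\<lambda>z. \<lambda>i\<in>J. z (unskip k i)"
  define f where "f x = ennreal (multi_qNormal_density q (Suc d) m \<sigma> \<rho> x)" for x
  define g where "g z = ennreal (multi_qNormal_density q d (m \<circ> skip k) (\<sigma> \<circ> skip k) (merge_corr k \<rho>) z)" for z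
  have I: "?I = insert ?n J" and n: "?n \<notin> J" and J: "finite J"
    using k by (auto simp: J_def)
  have bij: "bij_betw (skip k) ?D J"
    using bij_betw_skip[OF k] by (simp add: J_def)
  then have skip: "skip k \<in> ?D \<rightarrow> J"
    by (auto simp: bij_betw_def)
  then have skip': "skip k \<in> ?D \<rightarrow> ?I"
    unfolding I by auto
  have unskip: "unskip k \<in> J \<rightarrow> ?D"
    using k by (auto simp: J_def unskip_def split: if_splits)
  have f: "f \<in> borel_measurable (?L ?I)" and Y: "?Y \<in> M \<rightarrow>\<^sub>M ?L ?I" and XY: "distr M (?L ?I) ?Y = density (?L ?I) f"
    using X unfolding f_def by (auto simp: distributed_def)
  have T: "?T \<in> ?L ?I \<rightarrow>\<^sub>M ?L ?D" and T': "?T \<in> ?L J \<rightarrow>\<^sub>M ?L ?D" and R: "?R \<in> ?L ?D \<rightarrow>\<^sub>M ?L J"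
    using skip skip' unskip by (auto intro!: measurable_reindex)
  have fg: "(\<integral>\<^sup>+y. f (x(?n := y)) \<partial>lborel) = g z" if "\<And>j. j \<in> ?D \<Longrightarrow> z j = x (skip k j)" for x z
    unfolding f_def g_def
    using nn_integral_multi_qNormal_density[where m = m and \<sigma> = \<sigma> and \<rho> = \<rho> and x = x and z = z, OF q d k] \<sigma> \<rho> that
    by (simp only: )
  \<comment> \<open>\<open>g\<close> is the integral of \<open>f\<close> over the deleted
    coordinate, with \<open>?R\<close> restoring the old numbering; hence it inherits the
    measurability of \<open>f\<close>, which is part of the hypothesis on X.\<close>
  have g: "g \<in> borel_measurable (?L ?D)"
  proof -
    have "(\<lambda>(x, y). x(?n := y)) \<in> ?L J \<Otimes>\<^sub>M lborel \<rightarrow>\<^sub>M ?L ?I"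
      unfolding I by (rule measurable_add_dim)
    from measurable_compose[OF this f] have "(\<lambda>(x, y). f (x(?n := y))) \<in> borel_measurable (?L J \<Otimes>\<^sub>M lborel)"
      by (simp add: case_prod_unfold)
    then have "(\<lambda>x. \<integral>\<^sup>+y. f (x(?n := y)) \<partial>lborel) \<in> borel_measurable (?L J)"
      by (rule lborel.borel_measurable_nn_integral)
    from measurable_compose[OF R this] have "(\<lambda>z. \<integral>\<^sup>+y. f ((?R z)(?n := y)) \<partial>lborel) \<in> borel_measurable (?L ?D)" .
    also have "(\<lambda>z. \<integral>\<^sup>+y. f ((?R z)(?n := y)) \<partial>lborel) = g"
      using skip by (intro ext fg) auto
    finally show ?thesis .
  qed
  have TY: "?T (?Y \<omega>) = (\<lambda>j\<in>?D. X (skip k j) \<omega>)" for \<omega>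
    using skip' by (auto simp: fun_eq_iff)
  have "distr M (?L ?D) (\<lambda>\<omega>. \<lambda>j\<in>?D. X (skip k j) \<omega>) = distr (distr M (?L ?I) ?Y) (?L ?D) ?T"
    using distr_distr[OF T Y] by (simp only: o_def TY)
  also have "\<dots> = distr (density (?L ?I) f) (?L ?D) ?T"
    by (simp only: XY)
  also have "\<dots> = density (?L ?D) g"
  proof (rule measure_eqI)
    fix A assume "A \<in> sets (distr (density (?L ?I) f) (?L ?D) ?T)"
    then have A: "A \<in> sets (?L ?D)" by simp
    have "emeasure (distr (density (?L ?I) f) (?L ?D) ?T) A = (\<integral>\<^sup>+x. indicator A x \<partial>distr (density (?L ?I) f) (?L ?D) ?T)"
      using A by simp
    also have "\<dots> = (\<integral>\<^sup>+x. indicator A (?T x) \<partial>density (?L ?I) f)"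
      using A T by (intro nn_integral_distr) simp_all
    also have "\<dots> = (\<integral>\<^sup>+x. f x * indicator A (?T x) \<partial>?L ?I)"
      using A T f by (intro nn_integral_density) (auto intro: measurable_compose[OF T])
    also have "\<dots> = (\<integral>\<^sup>+x. \<integral>\<^sup>+y. f (x(?n := y)) * indicator A (?T (x(?n := y))) \<partial>lborel \<partial>?L J)"
    proof -
      have "(\<lambda>x. f x * indicator A (?T x)) \<in> borel_measurable (?L ?I)"
        using f measurable_compose[OF T borel_measurable_indicator[OF A]]
        by (rule borel_measurable_times_ennreal)
      then show ?thesis
        unfolding I by (intro lborel_product.product_nn_integral_insert n J) auto
    qed
    also have "\<dots> = (\<integral>\<^sup>+x. g (?T x) * indicator A (?T x) \<partial>?L J)"
    proof (rule nn_integral_cong)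
      fix x assume x: "x \<in> space (?L J)"
      \<comment> \<open>\<open>?T\<close> never reads the deleted coordinate, so the indicator can
        leave the inner integral.\<close>
      have T_upd: "?T (x(?n := y)) = ?T x" for y
        by (auto simp: skip_def fun_eq_iff)
      have "(\<lambda>y. x(?n := y)) \<in> lborel \<rightarrow>\<^sub>M ?L ?I"
        unfolding I using x by (intro measurable_fun_upd[where J = J]) auto
      then have "(\<lambda>y. f (x(?n := y))) \<in> borel_measurable lborel"
        using f by (rule measurable_compose)
      then show "(\<integral>\<^sup>+y. f (x(?n := y)) * indicator A (?T (x(?n := y))) \<partial>lborel) = g (?T x) * indicator A (?T x)"
        unfolding T_upd using fg[of "?T x" x] by (subst nn_integral_multc) auto
    qed
    also have "\<dots> = (\<integral>\<^sup>+z. g z * indicator A z \<partial>distr (?L J) (?L ?D) ?T)"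
      using A g by (intro nn_integral_distr[OF T', symmetric]) simp
    also have "\<dots> = emeasure (density (?L ?D) g) A"
      using A g bij by (simp add: distr_PiM_lborel_reindex emeasure_density)
    finally show "emeasure (distr (density (?L ?I) f) (?L ?D) ?T) A = emeasure (density (?L ?D) g) A" .
  qed simp
  finally have "distr M (?L ?D) (\<lambda>\<omega>. \<lambda>j\<in>?D. X (skip k j) \<omega>) = density (?L ?D) g" .
  moreover have "(\<lambda>\<omega>. \<lambda>j\<in>?D. X (skip k j) \<omega>) \<in> M \<rightarrow>\<^sub>M ?L ?D"
    using measurable_compose[OF Y T] by (simp only: TY)
  ultimately show ?thesis
    using g unfolding distributed_def g_def by simp
qed

text \<open>A finite set has only one increasing enumeration: two sorted distinct lists with the
  same elements are equal, in length and entry by entry.\<close>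

lemma strict_mono_on_onto_atLeastAtMost:
  fixes \<iota> :: "nat \<Rightarrow> nat"
  assumes "strict_mono_on {1..p} \<iota>" "\<iota> ` {1..p} = {1..d}"
  shows "p = d" "j \<in> {1..p} \<Longrightarrow> \<iota> j = j"
proof -
  have inj: "inj_on \<iota> {1..p}"
    using assms(1) by (rule strict_mono_on_imp_inj_on)
  have eq: "map \<iota> [1..<Suc p] = [1..<Suc d]"
  proof (rule sorted_distinct_set_unique)
    have "sorted_wrt (\<lambda>x y. \<iota> x \<le> \<iota> y) [1..<Suc p]"
      by (rule sorted_wrt_mono_rel[OF _ sorted_wrt_upt])
        (use assms(1) in \<open>auto simp: strict_mono_on_def intro: less_imp_le simp del: upt_Suc\<close>)
    then show "sorted (map \<iota> [1..<Suc p])"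
      by (simp add: sorted_map)
    show "distinct (map \<iota> [1..<Suc p])"
      using inj by (simp add: distinct_map atLeastLessThanSuc_atLeastAtMost del: upt_Suc)
    show "set (map \<iota> [1..<Suc p]) = set [1..<Suc d]"
      using assms(2) by (simp add: atLeastLessThanSuc_atLeastAtMost del: upt_Suc)
  qed (simp_all del: upt_Suc)
  from arg_cong[OF eq, of length] show pd: "p = d"
    by (simp del: upt_Suc)
  show "\<iota> j = j" if "j \<in> {1..p}"
  proof -
    have "map \<iota> [1..<Suc p] = map id [1..<Suc p]"
      using eq pd by simp
    then have "\<forall>j\<in>set [1..<Suc p]. \<iota> j = id j"
      by (simp only: map_eq_conv)
    then show ?thesis
      using that by (simp del: upt_Suc)
  qed
qed

text \<open>Induction on d deletes one unselected coordinate at a time; when none is left, the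
  selection is the identity. The values of m' and \<sigma>' are tracked because the one-dimensional
  claim needs them, whereas for the merged correlations only the bound is kept.\<close>

lemma distributed_marginal:
  fixes X :: "nat \<Rightarrow> 'a \<Rightarrow> real" and \<iota> :: "nat \<Rightarrow> nat"
  assumes q: "- 1 < q" "q \<le> 1" and p: "1 \<le> p"
    and \<iota>: "strict_mono_on {1..p} \<iota>" "\<iota> ` {1..p} \<subseteq> {1..d}"
    and \<sigma>: "\<And>i. i \<in> {1..d} \<Longrightarrow> 0 < \<sigma> i"
    and \<rho>: "\<And>i. i \<in> {1..<d} \<Longrightarrow> \<bar>\<rho> i\<bar> < 1"
    and X: "distributed M (\<Pi>\<^sub>M i\<in>{1..d}. lborel) (\<lambda>\<omega>. \<lambda>i\<in>{1..d}. X i \<omega>)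
      (\<lambda>x. ennreal (multi_qNormal_density q d m \<sigma> \<rho> x))"
  shows "\<exists>m' \<sigma>' \<rho>'. (\<forall>j\<in>{1..p}. m' j = m (\<iota> j) \<and> \<sigma>' j = \<sigma> (\<iota> j)) \<and> (\<forall>j\<in>{1..<p}. \<bar>\<rho>' j\<bar> < 1) \<and>
    distributed M (\<Pi>\<^sub>M j\<in>{1..p}. lborel) (\<lambda>\<omega>. \<lambda>j\<in>{1..p}. X (\<iota> j) \<omega>)
      (\<lambda>x. ennreal (multi_qNormal_density q p m' \<sigma>' \<rho>' x))"
  using \<iota> \<sigma> \<rho> X
proof (induction d arbitrary: \<iota> m \<sigma> \<rho> X)
  case 0
  then show ?case using p by auto
next
  case (Suc d)
  note \<iota> = Suc.prems(1,2) and \<sigma> = Suc.prems(3) and \<rho> = Suc.prems(4) and X = Suc.prems(5)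
  show ?case
  proof (cases "\<iota> ` {1..p} = {1..Suc d}")
    case True
    note id = strict_mono_on_onto_atLeastAtMost[OF \<iota>(1) True]
    have eq: "(\<lambda>\<omega>. \<lambda>j\<in>{1..p}. X (\<iota> j) \<omega>) = (\<lambda>\<omega>. \<lambda>i\<in>{1..Suc d}. X i \<omega>)"
      using id by (auto simp: fun_eq_iff restrict_def)
    have "distributed M (\<Pi>\<^sub>M j\<in>{1..p}. lborel) (\<lambda>\<omega>. \<lambda>j\<in>{1..p}. X (\<iota> j) \<omega>)
        (\<lambda>x. ennreal (multi_qNormal_density q p m \<sigma> \<rho> x))"
      unfolding eq unfolding id(1) by (rule X)
    moreover have "\<forall>j\<in>{1..p}. m j = m (\<iota> j) \<and> \<sigma> j = \<sigma> (\<iota> j)" "\<forall>j\<in>{1..<p}. \<bar>\<rho> j\<bar> < 1"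
      using id \<rho> by auto
    ultimately show ?thesis
      by blast
  next
    case False
    then obtain n where n: "n \<in> {1..Suc d}" "n \<notin> \<iota> ` {1..p}"
      using \<iota>(2) by blast
    then obtain k where k: "n = Suc k" "k \<le> d"
      by (cases n) auto
    have ne: "\<iota> j \<noteq> Suc k" if "j \<in> {1..p}" for j
      using n(2) k(1) that by (metis imageI)
    \<comment> \<open>For d = 0 the only available index would be n, which \<iota> avoids, although
      p >= 1 forces it to take a value.\<close>
    have d: "1 \<le> d"
    proof (rule ccontr)
      assume "\<not> 1 \<le> d"
      then have "\<iota> 1 = n"
        using \<iota>(2) p n(1) by force
      then show False
        using n(2) p by auto
    qed
    let ?\<iota> = "\<lambda>j. unskip k (\<iota> j)"
    have skip: "skip k (?\<iota> j) = \<iota> j" if "j \<in> {1..p}" for j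
      using ne[OF that] by (rule skip_unskip)
    have mono: "strict_mono_on {1..p} ?\<iota>"
    proof (rule strict_mono_onI)
      fix r s assume rs: "r \<in> {1..p}" "s \<in> {1..p}" "r < s"
      have "\<iota> r < \<iota> s"
        by (rule strict_mono_onD[OF \<iota>(1) rs])
      then show "?\<iota> r < ?\<iota> s"
        using ne[OF rs(1)] ne[OF rs(2)] by (auto simp: unskip_def)
    qed
    have sub: "?\<iota> ` {1..p} \<subseteq> {1..d}"
    proof
      fix i assume "i \<in> ?\<iota> ` {1..p}"
      then obtain j where j: "j \<in> {1..p}" "i = ?\<iota> j" by auto
      have "\<iota> j \<in> {1..Suc d}"
        by (rule subsetD[OF \<iota>(2) imageI[OF j(1)]])
      then show "i \<in> {1..d}"
        using ne[OF j(1)] j(2) k(2) by (auto simp: unskip_def)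
    qed
    have \<sigma>': "0 < (\<sigma> \<circ> skip k) j" if "j \<in> {1..d}" for j
      using that k(2) by (auto simp: skip_def intro!: \<sigma>)
    have \<rho>': "\<bar>merge_corr k \<rho> j\<bar> < 1" if "j \<in> {1..<d}" for j
      using that k(2) by (auto simp: merge_corr_def intro!: \<rho> abs_mult_less_1)
    from Suc.IH[OF mono sub \<sigma>' \<rho>' distributed_delete_coordinate[OF q d k(2) \<sigma> \<rho> X]]
    obtain m' \<sigma>' \<rho>' where *: "\<forall>j\<in>{1..p}. m' j = (m \<circ> skip k) (?\<iota> j) \<and> \<sigma>' j = (\<sigma> \<circ> skip k) (?\<iota> j)"
      "\<forall>j\<in>{1..<p}. \<bar>\<rho>' j\<bar> < 1"
      "distributed M (\<Pi>\<^sub>M j\<in>{1..p}. lborel) (\<lambda>\<omega>. \<lambda>j\<in>{1..p}. X (skip k (?\<iota> j)) \<omega>)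
        (\<lambda>x. ennreal (multi_qNormal_density q p m' \<sigma>' \<rho>' x))"
      by blast
    have "(\<lambda>\<omega>. \<lambda>j\<in>{1..p}. X (skip k (?\<iota> j)) \<omega>) = (\<lambda>\<omega>. \<lambda>j\<in>{1..p}. X (\<iota> j) \<omega>)"
      using skip by (intro ext restrict_ext) simp
    with *(3) have "distributed M (\<Pi>\<^sub>M j\<in>{1..p}. lborel) (\<lambda>\<omega>. \<lambda>j\<in>{1..p}. X (\<iota> j) \<omega>)
        (\<lambda>x. ennreal (multi_qNormal_density q p m' \<sigma>' \<rho>' x))"
      by (simp only: )
    moreover have "\<forall>j\<in>{1..p}. m' j = m (\<iota> j) \<and> \<sigma>' j = \<sigma> (\<iota> j)"
      using *(1) skip by simp
    ultimately show ?thesis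
      using *(2) by blast
  qed
qed

text \<open>Functions on one index are identified with reals by the projection, which carries the
  one-fold product measure to Lebesgue measure.\<close>

lemma distributed_singleton:
  fixes Y :: "'a \<Rightarrow> real" and i :: nat
  assumes "distributed M (\<Pi>\<^sub>M j\<in>{i}. lborel) (\<lambda>\<omega>. \<lambda>j\<in>{i}. Y \<omega>) (\<lambda>x. f (x i))"
    and "f \<in> borel_measurable lborel"
  shows "distributed M lborel Y f"
proof -
  let ?L = "\<Pi>\<^sub>M j\<in>{i}. lborel :: real measure"
  have Y: "(\<lambda>\<omega>. \<lambda>j\<in>{i}. Y \<omega>) \<in> M \<rightarrow>\<^sub>M ?L"
    and eq: "distr M ?L (\<lambda>\<omega>. \<lambda>j\<in>{i}. Y \<omega>) = density ?L (\<lambda>x. f (x i))"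
    using assms(1) by (auto simp: distributed_def)
  have proj: "(\<lambda>x. x i) \<in> ?L \<rightarrow>\<^sub>M lborel"
    by (rule measurable_component_singleton) simp
  have comp: "(\<lambda>x. x i) \<circ> (\<lambda>\<omega>. \<lambda>j\<in>{i}. Y \<omega>) = Y"
    by (simp add: fun_eq_iff)
  have "distr M lborel Y = distr (distr M ?L (\<lambda>\<omega>. \<lambda>j\<in>{i}. Y \<omega>)) lborel (\<lambda>x. x i)"
    using distr_distr[OF proj Y] by (simp only: comp)
  also have "\<dots> = density (distr ?L lborel (\<lambda>x. x i)) f"
    unfolding eq by (rule density_distr[OF assms(2) proj, symmetric])
  also have "distr ?L lborel (\<lambda>x. x i) = lborel"
    by (rule lborel_product.distr_singleton)
  finally show ?thesis
    using assms(2) measurable_comp[OF Y proj] by (simp add: distributed_def comp)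
qed

theorem corollary1:
  fixes M :: "'a measure"
    and X :: "nat \<Rightarrow> 'a \<Rightarrow> real"
    and q :: real
    and d :: nat
    and m \<sigma> \<rho> :: "nat \<Rightarrow> real"
  assumes "prob_space M"
    and "- 1 < q" "q \<le> 1"
    and "1 \<le> d"
    and "\<forall>i\<in>{1..d}. 0 < \<sigma> i"
    and "\<forall>i\<in>{1..<d}. - 1 < \<rho> i \<and> \<rho> i < 1"
    and "distributed M (\<Pi>\<^sub>M i\<in>{1..d}. lborel) (\<lambda>\<omega>. \<lambda>i\<in>{1..d}. X i \<omega>)
           (\<lambda>x. ennreal (multi_qNormal_density q d m \<sigma> \<rho> x))"
  shows "(\<forall>p\<ge>1. \<forall>\<iota> :: nat \<Rightarrow> nat.
            strict_mono_on {1..p} \<iota> \<and> \<iota> ` {1..p} \<subseteq> {1..d} \<longrightarrow>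
            (\<exists>m' \<sigma>' \<rho>' :: nat \<Rightarrow> real.
               (\<forall>j\<in>{1..p}. 0 < \<sigma>' j) \<and>
               (\<forall>j\<in>{1..<p}. - 1 < \<rho>' j \<and> \<rho>' j < 1) \<and>
               distributed M (\<Pi>\<^sub>M j\<in>{1..p}. lborel) (\<lambda>\<omega>. \<lambda>j\<in>{1..p}. X (\<iota> j) \<omega>)
                 (\<lambda>x. ennreal (multi_qNormal_density q p m' \<sigma>' \<rho>' x))))
       \<and> (\<forall>i\<in>{1..d}. distributed M lborel (X i)
            (\<lambda>x. ennreal (qNormal_density q (m i) (\<sigma> i) x)))"
proof -
  have \<sigma>: "\<And>i. i \<in> {1..d} \<Longrightarrow> 0 < \<sigma> i" and \<rho>: "\<And>i. i \<in> {1..<d} \<Longrightarrow> \<bar>\<rho> i\<bar> < 1"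
    using assms(5,6) by (auto simp: abs_less_iff minus_less_iff)
  note marginal = distributed_marginal[OF assms(2,3) _ _ _ \<sigma> \<rho> assms(7)]
  show ?thesis
  proof (intro conjI allI impI ballI)
    fix p :: nat and \<iota> :: "nat \<Rightarrow> nat"
    assume p: "1 \<le> p" and \<iota>: "strict_mono_on {1..p} \<iota> \<and> \<iota> ` {1..p} \<subseteq> {1..d}"
    then obtain m' \<sigma>' \<rho>' where *: "\<forall>j\<in>{1..p}. m' j = m (\<iota> j) \<and> \<sigma>' j = \<sigma> (\<iota> j)" "\<forall>j\<in>{1..<p}. \<bar>\<rho>' j\<bar> < 1"
      "distributed M (\<Pi>\<^sub>M j\<in>{1..p}. lborel) (\<lambda>\<omega>. \<lambda>j\<in>{1..p}. X (\<iota> j) \<omega>)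
        (\<lambda>x. ennreal (multi_qNormal_density q p m' \<sigma>' \<rho>' x))"
      using marginal[of p \<iota>] by blast
    have "\<forall>j\<in>{1..p}. 0 < \<sigma>' j"
      using *(1) \<iota> \<sigma> by auto
    moreover have "\<forall>j\<in>{1..<p}. - 1 < \<rho>' j \<and> \<rho>' j < 1"
      using *(2) by (auto simp: abs_less_iff)
    ultimately show "\<exists>m' \<sigma>' \<rho>'. (\<forall>j\<in>{1..p}. 0 < \<sigma>' j) \<and> (\<forall>j\<in>{1..<p}. - 1 < \<rho>' j \<and> \<rho>' j < 1) \<and>
        distributed M (\<Pi>\<^sub>M j\<in>{1..p}. lborel) (\<lambda>\<omega>. \<lambda>j\<in>{1..p}. X (\<iota> j) \<omega>)
          (\<lambda>x. ennreal (multi_qNormal_density q p m' \<sigma>' \<rho>' x))"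
      using *(3) by blast
  next
    fix i assume i: "i \<in> {1..d}"
    obtain m' \<sigma>' \<rho>' where *: "m' 1 = m i" "\<sigma>' 1 = \<sigma> i"
      "distributed M (\<Pi>\<^sub>M j\<in>{1::nat}. lborel) (\<lambda>\<omega>. \<lambda>j\<in>{1}. X i \<omega>)
        (\<lambda>x. ennreal (multi_qNormal_density q 1 m' \<sigma>' \<rho>' x))"
      \<comment> \<open>A selection of length 1: the constant function is vacuously strictly
        increasing on {1}.\<close>
      using marginal[of 1 "\<lambda>_. i"] i by (auto simp: strict_mono_on_def)
    have "distributed M (\<Pi>\<^sub>M j\<in>{1::nat}. lborel) (\<lambda>\<omega>. \<lambda>j\<in>{1}. X i \<omega>)
        (\<lambda>x. ennreal (qNormal_density q (m i) (\<sigma> i) (x 1)))"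
      using *(3) unfolding multi_qNormal_density_1 *(1,2) .
    moreover have "(\<lambda>x. ennreal (qNormal_density q (m i) (\<sigma> i) x)) \<in> borel_measurable lborel"
      using measurable_compose[OF _ borel_measurable_fN[OF assms(2,3)], of "\<lambda>x. (x - m i) / \<sigma> i" borel]
      by (simp add: qNormal_density_def)
    ultimately show "distributed M lborel (X i) (\<lambda>x. ennreal (qNormal_density q (m i) (\<sigma> i) x))"
      by (rule distributed_singleton)
  qed
qed

end
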